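(* Let $K$ be an infinite field. For any $p,n,m,d\in\mathbb{Z}_{\ge0}$, the topological space $$A_{p,n,m,d}:=(\mathrm{Mat}_{\mathbb{N},\mathbb{N}})^p\times\mathrm{Mat}_{\mathbb{N},n}\times\mathrm{Mat}_{m,\mathbb{N}}\times K^d$$ is equivariantly Noetherian with respect to $\mathrm{GL}_{\mathbb{N}}\times\mathrm{GL}_{\mathbb{N}}$. In other words, every $\mathrm{GL}_{\mathbb{N}}\times\mathrm{GL}_{\mathbb{N}}$-stable closed subset of $A_{p,n,m,d}$ is the common zero set of finitely many $\mathrm{GL}_{\mathbb{N}}\times\mathrm{GL}_{\mathbb{N}}$-orbits of polynomial equations.
   Context: $\mathbb{N}=\{1,2,3,\dots\}$. $\mathrm{Mat}_{\mathbb{N},\mathbb{N}}$ is the space of all $\mathbb{N}\times\mathbb{N}$-matrices over $K$ (no finiteness condition on entries); $\mathrm{Mat}_{\mathbb{N},n}$ and $\mathrm{Mat}_{m,\mathbb{N}}$ are the spaces of all $\mathbb{N}\times n$- and $m\times\mathbb{N}$-matrices over $K$. $A_{p,n,m,d}$ carries the Zariski topology, in which closed sets are the common zero sets of collections of polynomials (each in finitely many variables) in the entries of the $p+2$ matrices and the coordinates on $K^d$. $\mathrm{GL}_{\mathbb{N}}:=\bigcup_{n\in\mathbb{N}}\mathrm{GL}_n(K)$ is the group of invertible $\mathbb{N}\times\mathbb{N}$-matrices that differ from the identity matrix in only finitely many entries. The first copy acts by left multiplication (row operations) on $\mathrm{Mat}_{\mathbb{N},\mathbb{N}}$ and $\mathrm{Mat}_{\mathbb{N},n}$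 and trivially on $\mathrm{Mat}_{m,\mathbb{N}}$; the second copy acts by right multiplication (column operations) on $\mathrm{Mat}_{\mathbb{N},\mathbb{N}}$ and $\mathrm{Mat}_{m,\mathbb{N}}$ and trivially on $\mathrm{Mat}_{\mathbb{N},n}$. $\mathrm{GL}_{\mathbb{N}}\times\mathrm{GL}_{\mathbb{N}}$ acts diagonally on $A_{p,n,m,d}$ and trivially on $K^d$. A topological space on which a group $G$ acts by homeomorphisms is $G$-Noetherian (equivariantly Noetherian) if every descending chain of closed $G$-stable subsets stabilises. *)

theory Defs
  imports
    "HOL-Analysis.Abstract_Topology"
    "HOL-Algebra.Group_Action"
    "HOL-Library.Poly_Mapping"
    "HOL-Library.Groups_Big_Fun"
begin

section \<open>Infinite matrices and the group \<open>GL\<^sub>\<nat>\<close>\<close>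

text \<open>
  Rows and columns are indexed by \<^typ>\<open>nat\<close>, starting from \<open>0\<close>. Matrices with only finitely many
  rows or columns are padded with zeros.
\<close>

type_synonym 'a imat = "nat \<Rightarrow> nat \<Rightarrow> 'a"

definition imat_one :: "'a::zero_neq_one imat" where
  "imat_one i j = (if i = j then 1 else 0)"

text \<open>
  \<^const>\<open>Sum_any\<close> is the sum over all indices, provided that only finitely many summands are
  non-zero. That is the case whenever all rows of \<open>A\<close> or all columns of \<open>B\<close> are finite.
\<close>

definition imat_mult :: "'a::semiring_0 imat \<Rightarrow> 'a imat \<Rightarrow> 'a imat" where
  "imat_mult A B i j = Sum_any (\<lambda>l. A i l * B l j)"

definition finitary_imats :: "'a::field imat monoid" where
  "finitary_imats =
     \<lparr>carrier = {A. finite {(i, j). A i j \<noteq> imat_one i j}}, mult = imat_mult, one = imat_one\<rparr>"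

definition GL_inf :: "'a::field imat monoid" where
  "GL_inf = units_of finitary_imats"


section \<open>The space \<open>A\<close> and the action\<close>

type_synonym 'a point = "(nat \<Rightarrow> 'a imat) \<times> 'a imat \<times> 'a imat \<times> (nat \<Rightarrow> 'a)"

definition A_space :: "nat \<Rightarrow> nat \<Rightarrow> nat \<Rightarrow> nat \<Rightarrow> 'a::field point set" where
  "A_space p n m d =
     {M. \<forall>k\<ge>p. \<forall>i j. M k i j = 0} \<times>
     {P. \<forall>i. \<forall>j\<ge>n. P i j = 0} \<times>
     {Q. \<forall>i\<ge>m. \<forall>j. Q i j = 0} \<times>
     {v. \<forall>k\<ge>d. v k = 0}"

definition transform :: "'a::semiring_0 imat \<Rightarrow> 'a imat \<Rightarrow> 'a point \<Rightarrow> 'a point" where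
  "transform a b = (\<lambda>(M, P, Q, v).
     (\<lambda>k. imat_mult a (imat_mult (M k) b), imat_mult a P, imat_mult Q b, v))"

text \<open>
  The second factor acts by right multiplication with the inverse, so that one obtains a left
  action. (The orbits and stable sets are those of the right action by right multiplication.)
\<close>

definition A_act ::
  "nat \<Rightarrow> nat \<Rightarrow> nat \<Rightarrow> nat \<Rightarrow> 'a::field imat \<times> 'a imat \<Rightarrow> 'a point \<Rightarrow> 'a point" where
  "A_act p n m d = (\<lambda>(g, h). \<lambda>x\<in>A_space p n m d. transform g (inv\<^bsub>GL_inf\<^esub> h) x)"


section \<open>Polynomials on \<open>A\<close>\<close>

datatype coord = Mat_coord nat nat nat | Left_coord nat nat | Right_coord nat nat | Vec_coord nat

fun coord_of :: "'a point \<Rightarrow> coord \<Rightarrow> 'a" where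
  "coord_of (M, P, Q, v) (Mat_coord k i j) = M k i j"
| "coord_of (M, P, Q, v) (Left_coord i j) = P i j"
| "coord_of (M, P, Q, v) (Right_coord i j) = Q i j"
| "coord_of (M, P, Q, v) (Vec_coord k) = v k"

fun coord_valid :: "nat \<Rightarrow> nat \<Rightarrow> nat \<Rightarrow> nat \<Rightarrow> coord \<Rightarrow> bool" where
  "coord_valid p n m d (Mat_coord k i j) \<longleftrightarrow> k < p"
| "coord_valid p n m d (Left_coord i j) \<longleftrightarrow> j < n"
| "coord_valid p n m d (Right_coord i j) \<longleftrightarrow> i < m"
| "coord_valid p n m d (Vec_coord k) \<longleftrightarrow> k < d"

text \<open>
  Monomials are finitely supported exponent functions; a polynomial maps finitely many of them to
  non-zero coefficients.
\<close>

type_synonym ('v, 'a) mpol = "('v \<Rightarrow>\<^sub>0 nat) \<Rightarrow>\<^sub>0 'a"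

definition Const :: "'a::zero \<Rightarrow> ('v, 'a) mpol" where
  "Const c = Poly_Mapping.single 0 c"

definition Var :: "'v \<Rightarrow> ('v, 'a::zero_neq_one) mpol" where
  "Var v = Poly_Mapping.single (Poly_Mapping.single v 1) 1"

definition peval :: "('a \<Rightarrow> 'b) \<Rightarrow> ('v \<Rightarrow> 'b) \<Rightarrow> ('v, 'a::zero) mpol \<Rightarrow> 'b::comm_semiring_1" where
  "peval \<phi> \<sigma> f =
     (\<Sum>\<mu>\<in>Poly_Mapping.keys f. \<phi> (Poly_Mapping.lookup f \<mu>) *
        (\<Prod>v\<in>Poly_Mapping.keys \<mu>. \<sigma> v ^ Poly_Mapping.lookup \<mu> v))"

definition A_polys :: "nat \<Rightarrow> nat \<Rightarrow> nat \<Rightarrow> nat \<Rightarrow> (coord, 'a::field) mpol set" where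
  "A_polys p n m d =
     {f. \<forall>\<mu>\<in>Poly_Mapping.keys f. \<forall>c\<in>Poly_Mapping.keys \<mu>. coord_valid p n m d c}"

definition value_at :: "(coord, 'a::field) mpol \<Rightarrow> 'a point \<Rightarrow> 'a" where
  "value_at f x = peval id (coord_of x) f"

definition zero_set ::
  "nat \<Rightarrow> nat \<Rightarrow> nat \<Rightarrow> nat \<Rightarrow> (coord, 'a::field) mpol set \<Rightarrow> 'a point set" where
  "zero_set p n m d F = {x \<in> A_space p n m d. \<forall>f\<in>F. value_at f x = 0}"

definition generic_point :: "(coord, 'a::field) mpol point" where
  "generic_point =
     (\<lambda>k i j. Var (Mat_coord k i j), \<lambda>i j. Var (Left_coord i j),
      \<lambda>i j. Var (Right_coord i j), \<lambda>k. Var (Vec_coord k))"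

text \<open>
  The action on polynomials is \<open>(\<gamma> \<cdot> f)(x) = f(\<gamma>\<^sup>-\<^sup>1 \<cdot> x)\<close>: the coordinates of \<open>\<gamma>\<^sup>-\<^sup>1\<close>, applied to the
  generic point, are substituted into \<open>f\<close>. See \<open>value_at_poly_act\<close> below.
\<close>

definition poly_act ::
  "'a::field imat \<times> 'a imat \<Rightarrow> (coord, 'a) mpol \<Rightarrow> (coord, 'a) mpol" where
  "poly_act = (\<lambda>(g, h) f.
     peval Const
       (coord_of (transform (\<lambda>i j. Const ((inv\<^bsub>GL_inf\<^esub> g) i j)) (\<lambda>i j. Const (h i j)) generic_point))
       f)"


section \<open>The Zariski topology and equivariant Noetherianity\<close>

text \<open>\<open>zariski_istopology\<close> below shows that this is a topology; its closed sets are described in \<open>closedin_zariski\<close>.\<close>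

definition zariski :: "nat \<Rightarrow> nat \<Rightarrow> nat \<Rightarrow> nat \<Rightarrow> 'a::field point topology" where
  "zariski p n m d =
     topology (\<lambda>U. U \<subseteq> A_space p n m d \<and>
       (\<exists>F\<subseteq>A_polys p n m d. A_space p n m d - U = zero_set p n m d F))"

definition acts_by_homeomorphisms ::
  "('g, 'c) monoid_scheme \<Rightarrow> 'x topology \<Rightarrow> ('g \<Rightarrow> 'x \<Rightarrow> 'x) \<Rightarrow> bool" where
  "acts_by_homeomorphisms G X \<phi> \<longleftrightarrow>
     group_action G (topspace X) \<phi> \<and> (\<forall>g\<in>carrier G. homeomorphic_map X X (\<phi> g))"

definition stable_set :: "('g, 'c) monoid_scheme \<Rightarrow> ('g \<Rightarrow> 'x \<Rightarrow> 'x) \<Rightarrow> 'x set \<Rightarrow> bool" where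
  "stable_set G \<phi> S \<longleftrightarrow> (\<forall>g\<in>carrier G. \<forall>x\<in>S. \<phi> g x \<in> S)"

definition equivariantly_noetherian ::
  "('g, 'c) monoid_scheme \<Rightarrow> 'x topology \<Rightarrow> ('g \<Rightarrow> 'x \<Rightarrow> 'x) \<Rightarrow> bool" where
  "equivariantly_noetherian G X \<phi> \<longleftrightarrow>
     acts_by_homeomorphisms G X \<phi> \<and>
     (\<forall>C :: nat \<Rightarrow> 'x set.
        (\<forall>i. closedin X (C i) \<and> stable_set G \<phi> (C i) \<and> C (Suc i) \<subseteq> C i) \<longrightarrow>
        (\<exists>N. \<forall>i\<ge>N. C i = C N))"


section \<open>The action by homeomorphisms\<close>

subsection \<open>Matrices and groups\<close>

definition row_fin :: "'a::zero imat \<Rightarrow> bool" where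
  "row_fin A \<longleftrightarrow> (\<forall>i. finite {l. A i l \<noteq> 0})"

definition col_fin :: "'a::zero imat \<Rightarrow> bool" where
  "col_fin A \<longleftrightarrow> (\<forall>j. finite {l. A l j \<noteq> 0})"

lemma imat_mult_superset:
  assumes "finite L" "\<And>l. l \<notin> L \<Longrightarrow> A i l * B l j = 0"
  shows "imat_mult A B i j = (\<Sum>l\<in>L. A i l * B l j)"
  unfolding imat_mult_def using assms by (intro Sum_any.expand_superset) auto

lemma imat_mult_assoc_aux:
  fixes A B C :: "'a::semiring_0 imat"
  assumes "finite L" "finite K"
    and L: "\<And>l k. l \<notin> L \<Longrightarrow> A i l * B l k = 0" "\<And>l. l \<notin> L \<Longrightarrow> A i l * imat_mult B C l j = 0"
    and K: "\<And>k l. k \<notin> K \<Longrightarrow> B l k * C k j = 0 \<or> A i l = 0" "\<And>k. k \<notin> K \<Longrightarrow> imat_mult A B i k * C k j = 0"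
  shows "imat_mult (imat_mult A B) C i j = imat_mult A (imat_mult B C) i j"
proof -
  have AB: "imat_mult A B i k = (\<Sum>l\<in>L. A i l * B l k)" for k
    using assms by (intro imat_mult_superset) auto
  have BC: "A i l * imat_mult B C l j = A i l * (\<Sum>k\<in>K. B l k * C k j)" for l
  proof (cases "A i l = 0")
    case False
    then have "imat_mult B C l j = (\<Sum>k\<in>K. B l k * C k j)"
      using assms by (intro imat_mult_superset) blast+
    then show ?thesis by simp
  qed simp
  have "imat_mult (imat_mult A B) C i j = (\<Sum>k\<in>K. imat_mult A B i k * C k j)"
    using assms by (intro imat_mult_superset) auto
  also have "\<dots> = (\<Sum>k\<in>K. \<Sum>l\<in>L. A i l * B l k * C k j)"
    by (simp add: AB sum_distrib_right)
  also have "\<dots> = (\<Sum>l\<in>L. A i l * (\<Sum>k\<in>K. B l k * C k j))"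
    by (subst sum.swap) (simp add: sum_distrib_left mult.assoc)
  also have "\<dots> = (\<Sum>l\<in>L. A i l * imat_mult B C l j)"
    by (simp add: BC)
  also have "\<dots> = imat_mult A (imat_mult B C) i j"
    using assms by (intro imat_mult_superset[symmetric]) auto
  finally show ?thesis .
qed

lemma imat_mult_assoc1:
  assumes "row_fin A" "row_fin B"
  shows "imat_mult (imat_mult A B) C = imat_mult A (imat_mult B C)"
proof (intro ext)
  fix i j
  let ?L = "{l. A i l \<noteq> 0}" let ?K = "\<Union>l\<in>?L. {k. B l k \<noteq> 0}"
  have fin: "finite ?L" "finite ?K" using assms unfolding row_fin_def by auto
  have "imat_mult A B i k = 0" if "k \<notin> ?K" for k
    using that fin by (subst imat_mult_superset[of ?L]) (auto intro!: sum.neutral)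
  then show "imat_mult (imat_mult A B) C i j = imat_mult A (imat_mult B C) i j"
    using fin by (intro imat_mult_assoc_aux[of ?L ?K]) auto
qed

lemma imat_mult_assoc2:
  assumes "row_fin A" "col_fin C"
  shows "imat_mult (imat_mult A B) C = imat_mult A (imat_mult B C)"
proof (intro ext)
  fix i j
  show "imat_mult (imat_mult A B) C i j = imat_mult A (imat_mult B C) i j"
    using assms unfolding row_fin_def col_fin_def
    by (intro imat_mult_assoc_aux[of "{l. A i l \<noteq> 0}" "{l. C l j \<noteq> 0}"]) auto
qed

lemma imat_mult_assoc3:
  assumes "col_fin B" "col_fin C"
  shows "imat_mult (imat_mult A B) C = imat_mult A (imat_mult B C)"
proof (intro ext)
  fix i j
  let ?K = "{l. C l j \<noteq> 0}" let ?L = "\<Union>l\<in>?K. {k. B k l \<noteq> 0}"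
  have fin: "finite ?L" "finite ?K" using assms unfolding col_fin_def by auto
  have BC: "imat_mult B C k j = 0" if "k \<notin> ?L" for k
    using that fin by (subst imat_mult_superset[of ?K]) (auto intro!: sum.neutral)
  have "imat_mult (imat_mult A B) C i j = (\<Sum>k\<in>?K. imat_mult A B i k * C k j)"
    using fin by (intro imat_mult_superset) auto
  also have "\<dots> = (\<Sum>k\<in>?K. (\<Sum>l\<in>?L. A i l * B l k) * C k j)"
  proof (intro sum.cong refl)
    fix k assume "k \<in> ?K"
    then have "imat_mult A B i k = (\<Sum>l\<in>?L. A i l * B l k)"
      using fin by (intro imat_mult_superset) auto
    then show "imat_mult A B i k * C k j = (\<Sum>l\<in>?L. A i l * B l k) * C k j" by simp
  qed
  also have "\<dots> = (\<Sum>k\<in>?K. \<Sum>l\<in>?L. A i l * B l k * C k j)"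
    by (simp add: sum_distrib_right)
  also have "\<dots> = (\<Sum>l\<in>?L. A i l * (\<Sum>k\<in>?K. B l k * C k j))"
    by (subst sum.swap) (simp add: sum_distrib_left mult.assoc)
  also have "\<dots> = (\<Sum>l\<in>?L. A i l * imat_mult B C l j)"
    using fin by (intro sum.cong refl) (subst imat_mult_superset[of ?K B], auto)
  also have "\<dots> = imat_mult A (imat_mult B C) i j"
    using fin BC by (intro imat_mult_superset[symmetric]) auto
  finally show "imat_mult (imat_mult A B) C i j = imat_mult A (imat_mult B C) i j" .
qed

lemma imat_one_mult [simp]: "imat_mult imat_one A = (A :: 'a::semiring_1 imat)"
proof (intro ext)
  fix i j
  show "imat_mult imat_one A i j = A i j"
    by (subst imat_mult_superset[of "{i}"]) (auto simp: imat_one_def)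
qed

lemma imat_mult_one [simp]: "imat_mult A imat_one = (A :: 'a::semiring_1 imat)"
proof (intro ext)
  fix i j
  show "imat_mult A imat_one i j = A i j"
    by (subst imat_mult_superset[of "{j}"]) (auto simp: imat_one_def)
qed

lemma finitary_row_fin:
  assumes "finite {(i, j). A i j \<noteq> imat_one i j}"
  shows "row_fin A"
  unfolding row_fin_def
proof
  fix i
  have "l \<in> insert i (snd ` {(i, j). A i j \<noteq> imat_one i j})" if "A i l \<noteq> 0" for l
    using that by (cases "l = i") (auto simp: imat_one_def intro!: image_eqI[of _ _ "(i, l)"])
  then have "{l. A i l \<noteq> 0} \<subseteq> insert i (snd ` {(i, j). A i j \<noteq> imat_one i j})" by blast
  then show "finite {l. A i l \<noteq> 0}"
    by (rule finite_subset) (intro finite.insertI finite_imageI assms)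
qed

lemma finitary_col_fin:
  assumes "finite {(i, j). A i j \<noteq> imat_one i j}"
  shows "col_fin A"
  unfolding col_fin_def
proof
  fix j
  have "l \<in> insert j (fst ` {(i, j). A i j \<noteq> imat_one i j})" if "A l j \<noteq> 0" for l
    using that by (cases "l = j") (auto simp: imat_one_def intro!: image_eqI[of _ _ "(l, j)"])
  then have "{l. A l j \<noteq> 0} \<subseteq> insert j (fst ` {(i, j). A i j \<noteq> imat_one i j})" by blast
  then show "finite {l. A l j \<noteq> 0}"
    by (rule finite_subset) (intro finite.insertI finite_imageI assms)
qed

lemma finitary_mult:
  fixes A B :: "'a::semiring_1 imat"
  assumes A: "finite {(i, j). A i j \<noteq> imat_one i j}" and B: "finite {(i, j). B i j \<noteq> imat_one i j}"
  shows "finite {(i, j). imat_mult A B i j \<noteq> imat_one i j}"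
proof -
  let ?D = "{(i, j). A i j \<noteq> imat_one i j} \<union> {(i, j). B i j \<noteq> imat_one i j}"
  let ?S = "fst ` ?D \<union> snd ` ?D"
  have fin: "finite ?S" using A B by auto
  have offA: "A i j = imat_one i j" and offB: "B i j = imat_one i j" if "i \<notin> ?S \<or> j \<notin> ?S" for i j
    using that by (force simp: image_iff)+
  have "imat_mult A B i j = imat_one i j" if "i \<notin> ?S \<or> j \<notin> ?S" for i j
  proof (cases "i \<in> ?S")
    case False
    then have "A i l = imat_one i l" for l using offA by blast
    then have "imat_mult A B i j = imat_mult imat_one B i j" unfolding imat_mult_def by presburger
    then show ?thesis using offB[OF that] by (simp only: imat_one_mult)
  next
    case True
    then have "B l j = imat_one l j" for l using offB that by blast
    then have "imat_mult A B i j = imat_mult A imat_one i j" unfolding imat_mult_def by presburger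
    then show ?thesis using offA[OF that] by (simp only: imat_mult_one)
  qed
  then have "{(i, j). imat_mult A B i j \<noteq> imat_one i j} \<subseteq> ?S \<times> ?S" by auto
  then show ?thesis using fin by (meson finite_SigmaI finite_subset)
qed

lemma monoid_finitary_imats: "monoid (finitary_imats :: 'a::field imat monoid)"
proof (rule monoidI)
  show "\<one>\<^bsub>finitary_imats\<^esub> \<in> carrier (finitary_imats :: 'a imat monoid)"
    by (simp add: finitary_imats_def)
next
  fix A B C :: "'a imat"
  assume "A \<in> carrier finitary_imats" "B \<in> carrier finitary_imats"
  then have fin: "finite {(i, j). A i j \<noteq> imat_one i j}" "finite {(i, j). B i j \<noteq> imat_one i j}"
    by (simp_all add: finitary_imats_def)
  show "A \<otimes>\<^bsub>finitary_imats\<^esub> B \<in> carrier finitary_imats"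
    unfolding finitary_imats_def monoid.simps partial_object.simps
    using finitary_mult[OF fin] by (simp only: mem_Collect_eq)
  show "A \<otimes>\<^bsub>finitary_imats\<^esub> B \<otimes>\<^bsub>finitary_imats\<^esub> C =
      A \<otimes>\<^bsub>finitary_imats\<^esub> (B \<otimes>\<^bsub>finitary_imats\<^esub> C)"
    unfolding finitary_imats_def monoid.simps
    by (rule imat_mult_assoc1[OF finitary_row_fin[OF fin(1)] finitary_row_fin[OF fin(2)]])
next
  fix A :: "'a imat"
  show "\<one>\<^bsub>finitary_imats\<^esub> \<otimes>\<^bsub>finitary_imats\<^esub> A = A" "A \<otimes>\<^bsub>finitary_imats\<^esub> \<one>\<^bsub>finitary_imats\<^esub> = A"
    unfolding finitary_imats_def monoid.simps by (rule imat_one_mult imat_mult_one)+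
qed

lemma group_GL_inf: "group (GL_inf :: 'a::field imat monoid)"
  unfolding GL_inf_def by (rule monoid.units_group[OF monoid_finitary_imats])

lemma mult_GL_inf [simp]: "g \<otimes>\<^bsub>GL_inf\<^esub> h = imat_mult g h"
  by (simp add: GL_inf_def units_of_mult finitary_imats_def)

lemma one_GL_inf [simp]: "\<one>\<^bsub>GL_inf\<^esub> = imat_one"
  by (simp add: GL_inf_def units_of_one finitary_imats_def)

lemma GL_inf_fin:
  assumes "g \<in> carrier GL_inf"
  shows "row_fin g" "col_fin g"
proof -
  have "finite {(i, j). g i j \<noteq> imat_one i j}"
    using assms by (auto simp: GL_inf_def units_of_carrier Units_def finitary_imats_def)
  then show "row_fin g" "col_fin g" by (auto intro: finitary_row_fin finitary_col_fin)
qed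

lemma carrier_GL_inf:
  "carrier (GL_inf :: 'a::field imat monoid) =
     {A. finite {(i, j). A i j \<noteq> imat_one i j} \<and>
        (\<exists>B. finite {(i, j). B i j \<noteq> imat_one i j} \<and> imat_mult A B = imat_one \<and> imat_mult B A = imat_one)}"
  unfolding GL_inf_def units_of_carrier Units_def finitary_imats_def
    monoid.simps partial_object.simps mem_Collect_eq Bex_def by blast

subsection \<open>Evaluation and substitution\<close>

lemma peval_superset:
  assumes "finite S" "Poly_Mapping.keys f \<subseteq> S" "\<phi> 0 = 0"
  shows "peval \<phi> \<sigma> f = (\<Sum>\<mu>\<in>S. \<phi> (Poly_Mapping.lookup f \<mu>) *
        (\<Prod>v\<in>Poly_Mapping.keys \<mu>. \<sigma> v ^ Poly_Mapping.lookup \<mu> v))"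
  unfolding peval_def using assms
  by (intro sum.mono_neutral_left) (auto simp: in_keys_iff)

lemma peval_zero [simp]: "peval \<phi> \<sigma> 0 = 0"
  by (simp add: peval_def)

lemma peval_single:
  assumes "\<phi> 0 = 0"
  shows "peval \<phi> \<sigma> (Poly_Mapping.single \<mu> c) =
     \<phi> c * (\<Prod>v\<in>Poly_Mapping.keys \<mu>. \<sigma> v ^ Poly_Mapping.lookup \<mu> v)"
  using assms by (simp add: peval_superset[of "{\<mu>}"])

lemma peval_add:
  fixes f g :: "('v, 'a::comm_monoid_add) mpol"
  assumes "\<phi> 0 = 0" "\<And>a b. \<phi> (a + b) = \<phi> a + \<phi> b"
  shows "peval \<phi> \<sigma> (f + g) = peval \<phi> \<sigma> f + peval \<phi> \<sigma> g"
proof -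
  let ?S = "Poly_Mapping.keys f \<union> Poly_Mapping.keys g"
  have "Poly_Mapping.keys (f + g) \<subseteq> ?S" by (rule keys_add)
  then show ?thesis
    using assms by (simp add: peval_superset[of ?S] lookup_add sum.distrib distrib_right)
qed

lemma peval_sum:
  fixes f :: "'i \<Rightarrow> ('v, 'a::comm_monoid_add) mpol"
  assumes "\<phi> 0 = 0" "\<And>a b. \<phi> (a + b) = \<phi> a + \<phi> b"
  shows "peval \<phi> \<sigma> (sum f I) = (\<Sum>i\<in>I. peval \<phi> \<sigma> (f i))"
  by (induction I rule: infinite_finite_induct) (simp_all add: peval_add assms)

lemma mpol_expand:
  fixes f :: "('v, 'a::comm_monoid_add) mpol"
  shows "f = (\<Sum>\<mu>\<in>Poly_Mapping.keys f. Poly_Mapping.single \<mu> (Poly_Mapping.lookup f \<mu>))"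
  by (rule poly_mapping_eqI) (simp add: lookup_sum lookup_single when_def sum.delta in_keys_iff)

lemma monom_add:
  "(\<Prod>v\<in>Poly_Mapping.keys (\<mu> + \<nu>). (\<sigma> v :: 'b::comm_semiring_1) ^ Poly_Mapping.lookup (\<mu> + \<nu>) v) =
   (\<Prod>v\<in>Poly_Mapping.keys \<mu>. \<sigma> v ^ Poly_Mapping.lookup \<mu> v) *
   (\<Prod>v\<in>Poly_Mapping.keys \<nu>. \<sigma> v ^ Poly_Mapping.lookup \<nu> v)"
proof -
  let ?S = "Poly_Mapping.keys \<mu> \<union> Poly_Mapping.keys \<nu>"
  have *: "(\<Prod>v\<in>Poly_Mapping.keys \<kappa>. \<sigma> v ^ Poly_Mapping.lookup \<kappa> v) =
      (\<Prod>v\<in>?S. \<sigma> v ^ Poly_Mapping.lookup \<kappa> v)" if "Poly_Mapping.keys \<kappa> \<subseteq> ?S" for \<kappa>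
    using that by (intro prod.mono_neutral_left) (auto simp: in_keys_iff)
  show ?thesis
    using * [of \<mu>] *[of \<nu>] *[of "\<mu> + \<nu>"] keys_add[of \<mu> \<nu>]
    by (simp add: lookup_add power_add prod.distrib)
qed

lemma peval_mult:
  fixes f g :: "('v, 'a::comm_semiring_1) mpol"
  assumes hom: "\<phi> 0 = 0" "\<And>a b. \<phi> (a + b) = \<phi> a + \<phi> b" "\<And>a b. \<phi> (a * b) = \<phi> a * \<phi> b"
  shows "peval \<phi> \<sigma> (f * g) = peval \<phi> \<sigma> f * peval \<phi> \<sigma> g"
proof -
  let ?t = "\<lambda>f \<mu>. Poly_Mapping.single \<mu> (Poly_Mapping.lookup f \<mu>) :: ('v, 'a) mpol"
  have "f * g = (\<Sum>\<mu>\<in>Poly_Mapping.keys f. ?t f \<mu>) * (\<Sum>\<nu>\<in>Poly_Mapping.keys g. ?t g \<nu>)"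
    using mpol_expand[of f] mpol_expand[of g] by simp
  also have "\<dots> = (\<Sum>\<mu>\<in>Poly_Mapping.keys f. \<Sum>\<nu>\<in>Poly_Mapping.keys g.
      Poly_Mapping.single (\<mu> + \<nu>) (Poly_Mapping.lookup f \<mu> * Poly_Mapping.lookup g \<nu>))"
    by (simp add: sum_product mult_single)
  finally have *: "f * g = (\<Sum>\<mu>\<in>Poly_Mapping.keys f. \<Sum>\<nu>\<in>Poly_Mapping.keys g.
      Poly_Mapping.single (\<mu> + \<nu>) (Poly_Mapping.lookup f \<mu> * Poly_Mapping.lookup g \<nu>))" .
  have "peval \<phi> \<sigma> (f * g) = (\<Sum>\<mu>\<in>Poly_Mapping.keys f. \<Sum>\<nu>\<in>Poly_Mapping.keys g.
      \<phi> (Poly_Mapping.lookup f \<mu>) * \<phi> (Poly_Mapping.lookup g \<nu>) *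
      ((\<Prod>v\<in>Poly_Mapping.keys \<mu>. \<sigma> v ^ Poly_Mapping.lookup \<mu> v) *
       (\<Prod>v\<in>Poly_Mapping.keys \<nu>. \<sigma> v ^ Poly_Mapping.lookup \<nu> v)))"
    unfolding * by (simp only: peval_sum peval_single monom_add hom)
  also have "\<dots> = peval \<phi> \<sigma> f * peval \<phi> \<sigma> g"
    unfolding peval_def sum_product by (simp only: mult_ac)
  finally show ?thesis .
qed

lemma peval_Const [simp]: "\<phi> 0 = 0 \<Longrightarrow> peval \<phi> \<sigma> (Const c) = \<phi> c"
  by (simp add: Const_def peval_single)

lemma peval_Var [simp]: "\<phi> 0 = 0 \<Longrightarrow> \<phi> 1 = 1 \<Longrightarrow> peval \<phi> \<sigma> (Var v) = \<sigma> v"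
  by (simp add: Var_def peval_single)

lemma Const_hom: "Const 0 = 0" "Const 1 = 1" "Const (a + b) = Const a + Const b"
  "Const (a * b) = Const a * Const (b :: 'a::comm_semiring_1)"
  by (simp_all add: Const_def single_add mult_single)

lemma value_at_simps [simp]:
  "value_at 0 x = 0" "value_at 1 x = 1" "value_at (f + g) x = value_at f x + value_at g x"
  "value_at (f * g) x = value_at f x * value_at g x" "value_at (Const c) x = c"
  "value_at (Var v) x = coord_of x v"
  using peval_Const[of id "coord_of x" "1 :: 'a::field"]
  by (simp_all add: value_at_def peval_add peval_mult Const_hom)

lemma value_at_sum: "value_at (sum f I) x = (\<Sum>i\<in>I. value_at (f i) x)"
  by (simp add: value_at_def peval_sum)

lemma value_at_prod: "value_at (prod f I) x = (\<Prod>i\<in>I. value_at (f i) x)"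
  by (induction I rule: infinite_finite_induct) simp_all

lemma value_at_power: "value_at (f ^ n) x = value_at f x ^ n"
  by (induction n) simp_all

lemma value_at_subst: "value_at (peval Const \<sigma> f) x = peval id (\<lambda>v. value_at (\<sigma> v) x) f"
  by (simp add: peval_def value_at_sum value_at_prod value_at_power)

lemma value_at_mult_left:
  assumes "row_fin a"
  shows "value_at (imat_mult (\<lambda>i j. Const (a i j)) B i j) x = imat_mult a (\<lambda>i j. value_at (B i j) x) i j"
  using assms unfolding row_fin_def
  by (subst (1 2) imat_mult_superset[of "{l. a i l \<noteq> 0}"]) (auto simp: Const_hom value_at_sum)

lemma value_at_mult_right:
  assumes "col_fin b"
  shows "value_at (imat_mult B (\<lambda>i j. Const (b i j)) i j) x = imat_mult (\<lambda>i j. value_at (B i j) x) b i j"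
  using assms unfolding col_fin_def
  by (subst (1 2) imat_mult_superset[of "{l. b l j \<noteq> 0}"]) (auto simp: Const_hom value_at_sum)

lemma value_at_transform:
  assumes "row_fin a" "col_fin b"
  shows "value_at (coord_of (transform (\<lambda>i j. Const (a i j)) (\<lambda>i j. Const (b i j)) generic_point) c) x =
     coord_of (transform a b x) c"
  by (cases x; cases c)
     (simp_all add: transform_def generic_point_def value_at_mult_left value_at_mult_right assms)

subsection \<open>The group action\<close>

lemma GL_inf_inv:
  assumes "g \<in> carrier GL_inf"
  shows "inv\<^bsub>GL_inf\<^esub> g \<in> carrier GL_inf" "imat_mult g (inv\<^bsub>GL_inf\<^esub> g) = imat_one"
    "imat_mult (inv\<^bsub>GL_inf\<^esub> g) g = imat_one" "inv\<^bsub>GL_inf\<^esub> (inv\<^bsub>GL_inf\<^esub> g) = g"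
  using assms group.inv_closed[OF group_GL_inf] group.r_inv[OF group_GL_inf]
    group.l_inv[OF group_GL_inf] group.inv_inv[OF group_GL_inf] by auto

lemma transform_transform:
  assumes "row_fin a" "row_fin a'" "col_fin b" "col_fin b'"
  shows "transform a b (transform a' b' x) = transform (imat_mult a a') (imat_mult b' b) x"
  using assms
  by (auto simp: transform_def imat_mult_assoc1 imat_mult_assoc3 imat_mult_assoc2 split: prod.split)

lemma transform_one: "transform imat_one imat_one x = (x :: 'a::semiring_1 point)"
  by (simp add: transform_def split: prod.split)

lemma transform_A_space: "x \<in> A_space p n m d \<Longrightarrow> transform a b x \<in> A_space p n m d"
  by (auto simp: A_space_def transform_def imat_mult_def)

lemma group_GL_GL: "group (GL_inf \<times>\<times> (GL_inf :: 'a::field imat monoid))"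
  by (rule DirProd_group[OF group_GL_inf group_GL_inf])

lemma A_act_one:
  "x \<in> A_space p n m d \<Longrightarrow> A_act p n m d \<one>\<^bsub>GL_inf \<times>\<times> GL_inf\<^esub> x = (x :: 'a::field point)"
  using monoid.inv_one[OF group.is_monoid[OF group_GL_inf[where 'a = 'a]]]
  by (simp add: A_act_def one_DirProd transform_one)

lemma A_act_mult:
  assumes "\<gamma> \<in> carrier (GL_inf \<times>\<times> GL_inf)" "\<delta> \<in> carrier (GL_inf \<times>\<times> GL_inf)" "x \<in> A_space p n m d"
  shows "A_act p n m d (\<gamma> \<otimes>\<^bsub>GL_inf \<times>\<times> GL_inf\<^esub> \<delta>) x = A_act p n m d \<gamma> (A_act p n m d \<delta> x)"
proof -
  obtain g h g' h' where *: "\<gamma> = (g, h)" "\<delta> = (g', h')" by (cases \<gamma>; cases \<delta>)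
  then have "g \<in> carrier GL_inf" "h \<in> carrier GL_inf" "g' \<in> carrier GL_inf" "h' \<in> carrier GL_inf"
    using assms by auto
  moreover from this have "inv\<^bsub>GL_inf\<^esub> (imat_mult h h') = imat_mult (inv\<^bsub>GL_inf\<^esub> h') (inv\<^bsub>GL_inf\<^esub> h)"
    using group.inv_mult_group[OF group_GL_inf, of h h'] by simp
  ultimately show ?thesis using assms(3) *
    by (simp add: A_act_def transform_A_space transform_transform GL_inf_fin GL_inf_inv)
qed

lemma A_act_closed: "x \<in> A_space p n m d \<Longrightarrow> A_act p n m d \<gamma> x \<in> A_space p n m d"
  by (cases \<gamma>) (simp add: A_act_def transform_A_space)

lemma A_act_extensional: "A_act p n m d \<gamma> \<in> extensional (A_space p n m d)"
  unfolding A_act_def by (cases \<gamma>) (simp only: case_prod_conv restrict_extensional)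

lemma A_act_inv:
  assumes "\<gamma> \<in> carrier (GL_inf \<times>\<times> GL_inf)" "x \<in> A_space p n m d"
  shows "A_act p n m d \<gamma> (A_act p n m d (inv\<^bsub>GL_inf \<times>\<times> GL_inf\<^esub> \<gamma>) x) = x"
    "A_act p n m d (inv\<^bsub>GL_inf \<times>\<times> GL_inf\<^esub> \<gamma>) (A_act p n m d \<gamma> x) = x"
  using A_act_mult[OF assms(1) group.inv_closed[OF group_GL_GL assms(1)] assms(2)]
    A_act_mult[OF group.inv_closed[OF group_GL_GL assms(1)] assms]
    group.r_inv[OF group_GL_GL assms(1)] group.l_inv[OF group_GL_GL assms(1)] A_act_one[OF assms(2)]
  by simp_all

lemma group_action_A_act:
  "group_action (GL_inf \<times>\<times> GL_inf) (A_space p n m d :: 'a::field point set) (A_act p n m d)"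
proof -
  let ?G = "GL_inf \<times>\<times> (GL_inf :: 'a imat monoid)" and ?A = "A_space p n m d :: 'a point set"
  have Bij: "A_act p n m d \<gamma> \<in> Bij ?A" if "\<gamma> \<in> carrier ?G" for \<gamma>
  proof -
    have "bij_betw (A_act p n m d \<gamma>) ?A ?A"
    proof (rule bij_betw_byWitness[where f' = "A_act p n m d (inv\<^bsub>?G\<^esub> \<gamma>)"])
      show "\<forall>x\<in>?A. A_act p n m d (inv\<^bsub>?G\<^esub> \<gamma>) (A_act p n m d \<gamma> x) = x"
        "\<forall>x\<in>?A. A_act p n m d \<gamma> (A_act p n m d (inv\<^bsub>?G\<^esub> \<gamma>) x) = x"
        using A_act_inv[OF that] by blast+
      show "A_act p n m d \<gamma> ` ?A \<subseteq> ?A" "A_act p n m d (inv\<^bsub>?G\<^esub> \<gamma>) ` ?A \<subseteq> ?A"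
        using A_act_closed by blast+
    qed
    then show ?thesis unfolding Bij_def using A_act_extensional by blast
  qed
  have "A_act p n m d (\<gamma> \<otimes>\<^bsub>?G\<^esub> \<delta>) = compose ?A (A_act p n m d \<gamma>) (A_act p n m d \<delta>)"
    if \<gamma>\<delta>: "\<gamma> \<in> carrier ?G" "\<delta> \<in> carrier ?G" for \<gamma> \<delta>
  proof (rule extensionalityI[where A = ?A])
    fix x assume x: "x \<in> ?A"
    show "A_act p n m d (\<gamma> \<otimes>\<^bsub>?G\<^esub> \<delta>) x = compose ?A (A_act p n m d \<gamma>) (A_act p n m d \<delta>) x"
      unfolding compose_eq[OF x] by (rule A_act_mult[OF \<gamma>\<delta> x])
  qed (rule A_act_extensional compose_extensional)+
  then have "A_act p n m d \<in> hom ?G (BijGroup ?A)"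
    using Bij by (simp add: hom_def BijGroup_def Pi_iff del: carrier_DirProd mult_DirProd split_paired_All)
  then show ?thesis
    unfolding group_action_def group_hom_def group_hom_axioms_def
    by (intro conjI group_GL_GL group_BijGroup)
qed

lemma value_at_poly_act:
  assumes "\<gamma> \<in> carrier (GL_inf \<times>\<times> GL_inf)" "x \<in> A_space p n m d"
  shows "value_at (poly_act \<gamma> f) x = value_at f (A_act p n m d (inv\<^bsub>GL_inf \<times>\<times> GL_inf\<^esub> \<gamma>) x)"
proof -
  obtain g h where *: "\<gamma> = (g, h)" by (cases \<gamma>)
  then have gh: "g \<in> carrier GL_inf" "h \<in> carrier GL_inf" using assms by auto
  have "A_act p n m d (inv\<^bsub>GL_inf \<times>\<times> GL_inf\<^esub> \<gamma>) x = transform (inv\<^bsub>GL_inf\<^esub> g) h x"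
    using assms(2) gh * by (simp add: A_act_def inv_DirProd[OF group_GL_inf group_GL_inf] GL_inf_inv)
  moreover have "value_at (poly_act \<gamma> f) x = value_at f (transform (inv\<^bsub>GL_inf\<^esub> g) h x)"
    unfolding poly_act_def * case_prod_conv value_at_subst
      value_at_transform[OF GL_inf_fin(1)[OF GL_inf_inv(1)[OF gh(1)]] GL_inf_fin(2)[OF gh(2)]]
    by (simp add: value_at_def)
  ultimately show ?thesis by simp
qed

subsection \<open>The topology\<close>

lemma A_polys_add: "f \<in> A_polys p n m d \<Longrightarrow> g \<in> A_polys p n m d \<Longrightarrow> f + g \<in> A_polys p n m d"
  using keys_add[of f g] unfolding A_polys_def mem_Collect_eq by blast

lemma A_polys_mult:
  assumes "f \<in> A_polys p n m d" "g \<in> A_polys p n m d"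
  shows "f * g \<in> A_polys p n m d"
  unfolding A_polys_def
proof (intro CollectI ballI)
  fix \<kappa> c assume "\<kappa> \<in> Poly_Mapping.keys (f * g)" and c: "c \<in> Poly_Mapping.keys \<kappa>"
  then obtain \<mu> \<nu> where *: "\<kappa> = \<mu> + \<nu>" "\<mu> \<in> Poly_Mapping.keys f" "\<nu> \<in> Poly_Mapping.keys g"
    using keys_mult[of f g] by blast
  have "c \<in> Poly_Mapping.keys \<mu> \<union> Poly_Mapping.keys \<nu>"
    using c keys_add[of \<mu> \<nu>] unfolding *(1) by (rule rev_subsetD)
  then show "coord_valid p n m d c"
    using *(2,3) assms unfolding A_polys_def mem_Collect_eq by blast
qed

lemma A_polys_Const [simp]: "Const c \<in> A_polys p n m d"
  by (auto simp: A_polys_def Const_def)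

lemma A_polys_zero_one [simp]: "0 \<in> A_polys p n m d" "1 \<in> A_polys p n m d"
  by (auto simp: A_polys_def)

lemma A_polys_Var: "coord_valid p n m d c \<Longrightarrow> Var c \<in> A_polys p n m d"
  by (auto simp: A_polys_def Var_def)

lemma A_polys_sum: "(\<And>i. i \<in> I \<Longrightarrow> f i \<in> A_polys p n m d) \<Longrightarrow> sum f I \<in> A_polys p n m d"
  by (induction I rule: infinite_finite_induct) (auto intro: A_polys_add)

lemma A_polys_prod: "(\<And>i. i \<in> I \<Longrightarrow> f i \<in> A_polys p n m d) \<Longrightarrow> prod f I \<in> A_polys p n m d"
  by (induction I rule: infinite_finite_induct) (auto intro: A_polys_mult)

lemma A_polys_power: "f \<in> A_polys p n m d \<Longrightarrow> f ^ k \<in> A_polys p n m d"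
  by (induction k) (auto intro: A_polys_mult)

lemma A_polys_imat_mult:
  assumes "\<And>l. A i l * B l j \<in> A_polys p n m d"
  shows "imat_mult A B i j \<in> A_polys p n m d"
  unfolding imat_mult_def Sum_any.expand_set using assms by (intro A_polys_sum) auto

lemma A_polys_poly_act:
  assumes "f \<in> A_polys p n m d"
  shows "poly_act \<gamma> f \<in> A_polys p n m d"
proof -
  have *: "coord_of (transform (\<lambda>i j. Const (a i j)) (\<lambda>i j. Const (b i j)) generic_point) c
      \<in> A_polys p n m d" if "coord_valid p n m d c" for a b :: "'a imat" and c
    using that
    by (cases c) (auto simp: transform_def generic_point_def
        intro!: A_polys_imat_mult A_polys_mult A_polys_Var)
  have "peval Const (coord_of (transform (\<lambda>i j. Const (a i j)) (\<lambda>i j. Const (b i j)) generic_point)) f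
      \<in> A_polys p n m d" for a b :: "'a imat"
    unfolding peval_def using assms
    by (intro A_polys_sum A_polys_mult A_polys_prod A_polys_power A_polys_Const *)
       (auto simp: A_polys_def)
  then show ?thesis by (cases \<gamma>) (simp add: poly_act_def)
qed

lemma zariski_istopology:
  "istopology (\<lambda>U. U \<subseteq> (A_space p n m d :: 'a::field point set) \<and>
       (\<exists>F\<subseteq>A_polys p n m d. A_space p n m d - U = zero_set p n m d F))"
proof -
  let ?A = "A_space p n m d :: 'a point set" and ?Z = "zero_set p n m d :: _ \<Rightarrow> 'a point set"
  let ?P = "A_polys p n m d :: (coord, 'a) mpol set"
  let ?cl = "\<lambda>U. \<exists>F\<subseteq>?P. ?A - U = ?Z F"
  show ?thesis
    unfolding istopology_def
  proof (intro conjI allI impI)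
    fix S T assume ST: "S \<subseteq> ?A \<and> ?cl S" "T \<subseteq> ?A \<and> ?cl T"
    from ST(1) obtain F where F: "F \<subseteq> ?P" "?A - S = ?Z F" by blast
    from ST(2) obtain G where G: "G \<subseteq> ?P" "?A - T = ?Z G" by blast
    let ?H = "(\<lambda>(f, g). f * g) ` (F \<times> G)"
    have *: "x \<in> ?Z F \<union> ?Z G \<longleftrightarrow> x \<in> ?Z ?H" for x
    proof -
      have "(\<forall>h\<in>?H. value_at h x = 0) \<longleftrightarrow> (\<forall>f\<in>F. \<forall>g\<in>G. value_at f x = 0 \<or> value_at g x = 0)"
        by (simp only: ball_simps split_paired_Ball_Sigma case_prod_conv value_at_simps mult_eq_0_iff)
      also have "\<dots> \<longleftrightarrow> (\<forall>f\<in>F. value_at f x = 0) \<or> (\<forall>g\<in>G. value_at g x = 0)" by blast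
      finally show ?thesis unfolding zero_set_def by blast
    qed
    have "?A - S \<inter> T = ?Z ?H" unfolding Diff_Int F(2) G(2) by (rule Set.set_eqI, rule *)
    moreover have "?H \<subseteq> ?P"
    proof
      fix h assume "h \<in> ?H"
      then obtain f g where "h = f * g" "f \<in> F" "g \<in> G" by auto
      then show "h \<in> ?P" using A_polys_mult[OF subsetD[OF F(1)] subsetD[OF G(1)]] by (simp only:)
    qed
    ultimately show "?cl (S \<inter> T)" by (intro exI[of _ ?H] conjI)
    show "S \<inter> T \<subseteq> ?A" using ST(1) by blast
  next
    fix K assume K: "\<forall>U\<in>K. U \<subseteq> ?A \<and> ?cl U"
    then show "\<Union>K \<subseteq> ?A" by blast
    from K have "\<forall>U\<in>K. \<exists>F. F \<subseteq> ?P \<and> ?A - U = ?Z F" by blast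
    then obtain F where F: "\<forall>U\<in>K. F U \<subseteq> ?P \<and> ?A - U = ?Z (F U)" by (rule bchoice[THEN exE])
    have *: "x \<in> ?A - \<Union>K \<longleftrightarrow> x \<in> ?Z (\<Union>U\<in>K. F U)" for x
    proof -
      have "x \<in> ?A - \<Union>K \<longleftrightarrow> x \<in> ?A \<and> (\<forall>U\<in>K. x \<in> ?A - U)" by blast
      also have "\<dots> \<longleftrightarrow> x \<in> ?A \<and> (\<forall>U\<in>K. x \<in> ?Z (F U))" using F by metis
      also have "\<dots> \<longleftrightarrow> x \<in> ?Z (\<Union>U\<in>K. F U)" unfolding zero_set_def by blast
      finally show ?thesis .
    qed
    have "?A - \<Union>K = ?Z (\<Union>U\<in>K. F U)" by (rule Set.set_eqI, rule *)
    moreover have "(\<Union>U\<in>K. F U) \<subseteq> ?P" using F by blast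
    ultimately show "?cl (\<Union>K)" by (intro exI[of _ "\<Union>U\<in>K. F U"] conjI)
  qed
qed

lemma openin_zariski:
  "openin (zariski p n m d) U \<longleftrightarrow> U \<subseteq> A_space p n m d \<and>
     (\<exists>F\<subseteq>A_polys p n m d. A_space p n m d - U = zero_set p n m d F)"
  unfolding zariski_def topology_inverse'[OF zariski_istopology] ..

lemma topspace_zariski: "topspace (zariski p n m d) = A_space p n m d"
proof -
  have "A_space p n m d - A_space p n m d = zero_set p n m d {1}" by (auto simp: zero_set_def)
  then have "openin (zariski p n m d) (A_space p n m d)"
    unfolding openin_zariski by (intro conjI exI[of _ "{1}"]) auto
  then have "A_space p n m d \<subseteq> topspace (zariski p n m d)" by (rule openin_subset)
  moreover have "topspace (zariski p n m d) \<subseteq> A_space p n m d"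
    using openin_topspace[of "zariski p n m d"] unfolding openin_zariski by (rule conjunct1)
  ultimately show ?thesis by (intro subset_antisym)
qed

lemma closedin_zariski:
  "closedin (zariski p n m d) (X :: 'a::field point set) \<longleftrightarrow> (\<exists>F\<subseteq>A_polys p n m d. X = zero_set p n m d F)"
proof -
  have sub: "zero_set p n m d F \<subseteq> A_space p n m d" for F :: "(coord, 'a) mpol set"
    unfolding zero_set_def by blast
  show ?thesis
  proof
    assume "closedin (zariski p n m d) X"
    then have "X \<subseteq> A_space p n m d"
      and "\<exists>F\<subseteq>A_polys p n m d. A_space p n m d - (A_space p n m d - X) = zero_set p n m d F"
      unfolding closedin_def topspace_zariski openin_zariski by simp_all
    then show "\<exists>F\<subseteq>A_polys p n m d. X = zero_set p n m d F"
      by (simp only: double_diff[OF _ order_refl])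
  next
    assume "\<exists>F\<subseteq>A_polys p n m d. X = zero_set p n m d F"
    then obtain F where F: "F \<subseteq> A_polys p n m d" "X = zero_set p n m d F" by blast
    have "A_space p n m d - (A_space p n m d - X) = zero_set p n m d F"
      unfolding F(2) by (rule double_diff[OF sub order_refl])
    then show "closedin (zariski p n m d) X"
      unfolding closedin_def topspace_zariski openin_zariski
      using F(1) sub[of F] F(2) by (intro conjI exI[of _ F] Diff_subset) simp_all
  qed
qed

lemma acts_by_homeomorphisms_A_act:
  "acts_by_homeomorphisms (GL_inf \<times>\<times> GL_inf) (zariski p n m d :: 'a::field point topology) (A_act p n m d)"
proof -
  let ?G = "GL_inf \<times>\<times> (GL_inf :: 'a imat monoid)" and ?X = "zariski p n m d :: 'a point topology"
  have inv: "inv\<^bsub>?G\<^esub> \<gamma> \<in> carrier ?G" "inv\<^bsub>?G\<^esub> (inv\<^bsub>?G\<^esub> \<gamma>) = \<gamma>" if "\<gamma> \<in> carrier ?G" for \<gamma>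
    using that group.inv_closed[OF group_GL_GL] group.inv_inv[OF group_GL_GL] by blast+
  have cont: "continuous_map ?X ?X (A_act p n m d \<gamma>)" if \<gamma>: "\<gamma> \<in> carrier ?G" for \<gamma>
    unfolding continuous_map_closedin topspace_zariski
  proof (intro conjI allI impI)
    show "A_act p n m d \<gamma> \<in> A_space p n m d \<rightarrow> A_space p n m d" by (auto intro: A_act_closed)
  next
    fix C assume "closedin ?X C"
    then obtain F where F: "F \<subseteq> A_polys p n m d" "C = zero_set p n m d F"
      unfolding closedin_zariski by blast
    have *: "value_at (poly_act (inv\<^bsub>?G\<^esub> \<gamma>) f) x = value_at f (A_act p n m d \<gamma> x)"
      if "x \<in> A_space p n m d" for f x
      using value_at_poly_act[OF inv(1)[OF \<gamma>] that] inv(2)[OF \<gamma>] by simp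
    have "x \<in> A_space p n m d \<and> A_act p n m d \<gamma> x \<in> C \<longleftrightarrow>
        x \<in> zero_set p n m d (poly_act (inv\<^bsub>?G\<^esub> \<gamma>) ` F)" for x
    proof (cases "x \<in> A_space p n m d")
      case True
      show ?thesis
        unfolding F(2) zero_set_def mem_Collect_eq ball_simps *[OF True]
        using True A_act_closed[OF True] by blast
    qed (simp add: zero_set_def)
    then have "{x \<in> A_space p n m d. A_act p n m d \<gamma> x \<in> C} =
        zero_set p n m d (poly_act (inv\<^bsub>?G\<^esub> \<gamma>) ` F)"
      by blast
    moreover have "poly_act (inv\<^bsub>?G\<^esub> \<gamma>) ` F \<subseteq> A_polys p n m d"
      using F A_polys_poly_act by blast
    ultimately show "closedin ?X {x \<in> A_space p n m d. A_act p n m d \<gamma> x \<in> C}"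
      unfolding closedin_zariski by blast
  qed
  have "homeomorphic_map ?X ?X (A_act p n m d \<gamma>)" if "\<gamma> \<in> carrier ?G" for \<gamma>
    unfolding homeomorphic_map_maps homeomorphic_maps_def topspace_zariski
  proof (intro exI[of _ "A_act p n m d (inv\<^bsub>?G\<^esub> \<gamma>)"] conjI ballI)
    show "continuous_map ?X ?X (A_act p n m d \<gamma>)" by (rule cont[OF that])
    show "continuous_map ?X ?X (A_act p n m d (inv\<^bsub>?G\<^esub> \<gamma>))" by (rule cont[OF inv(1)[OF that]])
  qed (rule A_act_inv[OF that]; assumption)+
  then show ?thesis
    unfolding acts_by_homeomorphisms_def topspace_zariski by (intro conjI ballI group_action_A_act)
qed

end

(*
  Noetherianity is used in the form: there are no sequences of points x i and polynomials f i
  with f i (x i) \<noteq> 0 such that f i vanishes on the orbit of x j for all i < j.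

  Suppose that f vanishes on the orbit of (M, P, Q, v), but not on all of Mat^p \<times> {(P, Q, v)}.
  Then a non-trivial linear combination of the matrices M k has rank at most K, where K depends
  only on the indices occurring in f: otherwise row and column operations that fix P and Q inside
  the window of f can prescribe the entries of all M k there. The rows of the required operation
  exist because operators that are linearly dependent at every vector have a non-trivial
  combination of finite rank.

  The induction on p freezes the matrices in f i at those of x i. By the case p = 0, some f i is
  non-zero somewhere on Mat^(p + 1) \<times> (the base point of a translate of x j) for infinitely many j.
  For these j, one of the matrices of x j is a linear combination of the others plus a matrix of
  rank at most K, so x j is the image of a point of A(p, n + K, m + K, d + p) under an equivariant
  polynomial map. For p = 0, every point is obtained by row and column operations, up to closure,
  from an n \<times> n and an m \<times> m matrix, and Hilbert's basis theorem applies.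
*)
theory Submission
  imports Defs "HOL-Library.Function_Algebras" "Jordan_Normal_Form.Char_Poly"
begin


section \<open>Hilbert's basis theorem\<close>

text \<open>
  Subsets of a type instead of rings as types, because the induction adjoins one variable at a time
  inside a fixed polynomial ring.
\<close>

definition is_subring :: "'r::comm_ring_1 set \<Rightarrow> bool" where
  "is_subring R \<longleftrightarrow> 0 \<in> R \<and> 1 \<in> R \<and>
     (\<forall>a\<in>R. \<forall>b\<in>R. a + b \<in> R \<and> a * b \<in> R) \<and> (\<forall>a\<in>R. - a \<in> R)"

definition lincomb :: "'r::comm_ring_1 set \<Rightarrow> (nat \<Rightarrow> 'r) \<Rightarrow> nat \<Rightarrow> 'r set" where
  "lincomb R f k = {\<Sum>i<k. r i * f i | r. range r \<subseteq> R}"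

text \<open>The ascending chain condition for ideals, phrased for generators: some term lies in the
  ideal generated by its predecessors.\<close>

definition noetherian_on :: "'r::comm_ring_1 set \<Rightarrow> bool" where
  "noetherian_on R \<longleftrightarrow> (\<forall>f. range f \<subseteq> R \<longrightarrow> (\<exists>k. f k \<in> lincomb R f k))"

definition polys_over :: "'r::comm_ring_1 set \<Rightarrow> 'r poly set" where
  "polys_over R = {q. \<forall>i. poly.coeff q i \<in> R}"

definition adjoin :: "'r::comm_ring_1 set \<Rightarrow> 'r \<Rightarrow> 'r set" where
  "adjoin R x = (\<lambda>q. poly q x) ` polys_over R"

section \<open>Closure properties of subrings, adjunctions and finite linear combinations\<close>

lemma is_subring_closed:
  assumes "is_subring R"
  shows "0 \<in> R" "1 \<in> R" "a \<in> R \<Longrightarrow> b \<in> R \<Longrightarrow> a + b \<in> R" "a \<in> R \<Longrightarrow> b \<in> R \<Longrightarrow> a * b \<in> R"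
    "a \<in> R \<Longrightarrow> - a \<in> R"
  using assms by (auto simp: is_subring_def)

lemma is_subring_sum: "is_subring R \<Longrightarrow> (\<And>i. i \<in> I \<Longrightarrow> f i \<in> R) \<Longrightarrow> sum f I \<in> R"
  by (induction I rule: infinite_finite_induct) (auto intro: is_subring_closed)

lemma is_subring_prod: "is_subring R \<Longrightarrow> (\<And>i. i \<in> I \<Longrightarrow> f i \<in> R) \<Longrightarrow> prod f I \<in> R"
  by (induction I rule: infinite_finite_induct) (auto intro: is_subring_closed)

lemma is_subring_power: "is_subring R \<Longrightarrow> a \<in> R \<Longrightarrow> a ^ k \<in> R"
  by (induction k) (auto intro: is_subring_closed)

lemma is_subring_polys_over:
  assumes "is_subring R"
  shows "is_subring (polys_over R)"
  unfolding is_subring_def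
  by (auto simp: polys_over_def coeff_mult is_subring_closed[OF assms] intro!: is_subring_sum[OF assms])

lemma is_subring_adjoin:
  assumes "is_subring R"
  shows "is_subring (adjoin R x)"
  unfolding is_subring_def adjoin_def
proof (intro conjI ballI)
  note closed = is_subring_closed[OF is_subring_polys_over[OF assms]]
  show "0 \<in> (\<lambda>q. poly q x) ` polys_over R" by (rule image_eqI[of _ _ 0]) (auto simp: closed)
  show "1 \<in> (\<lambda>q. poly q x) ` polys_over R" by (rule image_eqI[of _ _ 1]) (auto simp: closed)
  fix a assume "a \<in> (\<lambda>q. poly q x) ` polys_over R"
  then obtain p where p: "a = poly p x" "p \<in> polys_over R" by blast
  show "- a \<in> (\<lambda>q. poly q x) ` polys_over R"
    by (rule image_eqI[of _ _ "- p"]) (auto simp: closed p)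
  fix b assume "b \<in> (\<lambda>q. poly q x) ` polys_over R"
  then obtain q where q: "b = poly q x" "q \<in> polys_over R" by blast
  show "a + b \<in> (\<lambda>q. poly q x) ` polys_over R"
    by (rule image_eqI[of _ _ "p + q"]) (auto simp: closed p q)
  show "a * b \<in> (\<lambda>q. poly q x) ` polys_over R"
    by (rule image_eqI[of _ _ "p * q"]) (auto simp: closed p q)
qed

lemma adjoin_base:
  assumes "is_subring R"
  shows "R \<subseteq> adjoin R x" "x \<in> adjoin R x"
proof -
  show "R \<subseteq> adjoin R x"
  proof
    fix a assume "a \<in> R"
    then show "a \<in> adjoin R x"
      unfolding adjoin_def polys_over_def
      by (intro image_eqI[of _ _ "[:a:]"])
         (auto simp: coeff_pCons is_subring_closed[OF assms] split: nat.splits)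
  qed
  show "x \<in> adjoin R x"
    unfolding adjoin_def polys_over_def
    by (intro image_eqI[of _ _ "[:0, 1:]"])
       (auto simp: coeff_pCons is_subring_closed[OF assms] split: nat.splits)
qed

lemma lincomb_zero: "is_subring R \<Longrightarrow> 0 \<in> lincomb R f k"
  unfolding lincomb_def by (auto intro!: exI[of _ "\<lambda>_. 0"] simp: is_subring_closed)

lemma lincomb_add:
  assumes "is_subring R" "a \<in> lincomb R f k" "b \<in> lincomb R f k"
  shows "a + b \<in> lincomb R f k"
proof -
  obtain r s where "a = (\<Sum>i<k. r i * f i)" "range r \<subseteq> R" "b = (\<Sum>i<k. s i * f i)" "range s \<subseteq> R"
    using assms(2,3) by (auto simp: lincomb_def)
  then show ?thesis
    unfolding lincomb_def using is_subring_closed(3)[OF assms(1)]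
    by (auto intro!: exI[of _ "\<lambda>i. r i + s i"] simp: sum.distrib distrib_right)
qed

lemma lincomb_mult:
  assumes "is_subring R" "c \<in> R" "a \<in> lincomb R f k"
  shows "c * a \<in> lincomb R f k"
proof -
  obtain r where "a = (\<Sum>i<k. r i * f i)" "range r \<subseteq> R"
    using assms(3) by (auto simp: lincomb_def)
  then show ?thesis
    unfolding lincomb_def using is_subring_closed(4)[OF assms(1,2)]
    by (auto intro!: exI[of _ "\<lambda>i. c * r i"] simp: sum_distrib_left mult.assoc)
qed

lemma lincomb_base:
  assumes "is_subring R" "i < k"
  shows "f i \<in> lincomb R f k"
  unfolding lincomb_def using assms(2)
  by (auto intro!: exI[of _ "\<lambda>j. if j = i then 1 else 0"]
      simp: is_subring_closed[OF assms(1)] if_distrib if_distribR sum.delta cong: if_cong)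

lemma lincomb_sum:
  "is_subring R \<Longrightarrow> (\<And>i. i \<in> I \<Longrightarrow> g i \<in> lincomb R f k) \<Longrightarrow> sum g I \<in> lincomb R f k"
  by (induction I rule: infinite_finite_induct) (auto intro: lincomb_zero lincomb_add)

lemma lincomb_trans:
  assumes "is_subring R" "\<And>i. i < k \<Longrightarrow> g i \<in> lincomb R f K"
  shows "lincomb R g k \<subseteq> lincomb R f K"
proof
  fix a assume "a \<in> lincomb R g k"
  then obtain r where "a = (\<Sum>i<k. r i * g i)" "range r \<subseteq> R" by (auto simp: lincomb_def)
  then show "a \<in> lincomb R f K"
    using assms by (auto intro!: lincomb_sum lincomb_mult)
qed

lemma lincomb_mono: "is_subring R \<Longrightarrow> k \<le> K \<Longrightarrow> lincomb R f k \<subseteq> lincomb R f K"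
  by (rule lincomb_trans) (auto intro: lincomb_base)

text \<open>From a bad sequence \<open>q\<close>, build polynomials \<open>h k\<close> of least
  degree in the ideal of \<open>q\<close> outside the ideal of the earlier ones. Some leading
  coefficient is a combination of the earlier leading coefficients; cancelling it contradicts least
  degree.\<close>

theorem noetherian_on_polys_over:
  assumes R: "is_subring R" and noetherian_on: "noetherian_on R"
  shows "noetherian_on (polys_over R)"
  unfolding noetherian_on_def
proof (intro allI impI, rule ccontr)
  fix q assume q: "range q \<subseteq> polys_over R" and bad: "\<nexists>k. q k \<in> lincomb (polys_over R) q k"
  let ?L = "lincomb (polys_over R)"
  note R' = is_subring_polys_over[OF R]
  define I where "I = (\<Union>k. ?L q k)"
  \<comment> \<open>Finitely many elements of the union lie in a common stage.\<close>
  have I_union: "\<exists>K. \<forall>i<k. h i \<in> ?L q K" if "\<And>i. i < k \<Longrightarrow> h i \<in> I" for h and k :: nat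
    using that
  proof (induction k)
    case (Suc k)
    then obtain K where K: "\<forall>i<k. h i \<in> ?L q K" by auto
    obtain K' where "h k \<in> ?L q K'" using Suc.prems[of k] by (auto simp: I_def)
    then have "\<forall>i<Suc k. h i \<in> ?L q (max K K')"
      using K lincomb_mono[OF R', of K "max K K'" q] lincomb_mono[OF R', of K' "max K K'" q]
      by (auto simp: less_Suc_eq)
    then show ?case by blast
  qed auto
  \<comment> \<open>The condition on \<open>h k\<close> refers to the earlier values of
    \<open>h\<close>, so \<open>h\<close> comes from well-founded dependent choice.\<close>
  define P where "P h k r \<longleftrightarrow> r \<in> I \<and> r \<notin> ?L h k \<and>
      (\<forall>r'. r' \<in> I \<and> r' \<notin> ?L h k \<longrightarrow> degree r \<le> degree r')" for h :: "nat \<Rightarrow> 'a poly" and k r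
  have "\<exists>h. \<forall>k. P h k (h k)"
  proof (rule dependent_wf_choice[of less_than])
    fix f g :: "nat \<Rightarrow> 'a poly" and k r
    assume "\<And>z. (z, k) \<in> less_than \<Longrightarrow> f z = g z"
    then have "?L f k = ?L g k" unfolding lincomb_def by auto
    then show "P f k r = P g k r" unfolding P_def by simp
  next
    fix k h assume "\<And>i. (i, k) \<in> less_than \<Longrightarrow> P h i (h i)"
    then have "h i \<in> I" if "i < k" for i using that by (simp add: P_def)
    then obtain K where "\<forall>i<k. h i \<in> ?L q K" using I_union[of k h] by blast
    \<comment> \<open>The ideal of the earlier \<open>h i\<close> is contained in stage
      \<open>K\<close>, which misses \<open>q K\<close>; so candidates remain.\<close>
    then have "?L h k \<subseteq> ?L q K" by (intro lincomb_trans[OF R']) auto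
    moreover have "q K \<in> I" using lincomb_base[OF R', of K "Suc K" q] by (auto simp: I_def)
    ultimately have "q K \<in> I \<and> q K \<notin> ?L h k" using bad by blast
    from ex_has_least_nat[where P = "\<lambda>r. r \<in> I \<and> r \<notin> ?L h k" and m = degree, OF this]
    show "\<exists>r. P h k r" unfolding P_def by blast
  qed simp
  then obtain h where h: "\<And>k. P h k (h k)" by blast
  have hR: "h k \<in> polys_over R" for k
  proof -
    obtain K where "h k \<in> ?L q K" using h[of k] by (auto simp: P_def I_def)
    then show ?thesis
      by (auto simp: lincomb_def intro!: is_subring_sum[OF R'] is_subring_closed(4)[OF R']
          intro: range_subsetD[OF q] range_subsetD)
  qed
  then have "range (\<lambda>k. lead_coeff (h k)) \<subseteq> R" by (auto simp: polys_over_def)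
  with noetherian_on obtain k where "lead_coeff (h k) \<in> lincomb R (\<lambda>k. lead_coeff (h k)) k"
    unfolding noetherian_on_def by blast
  then obtain r where r: "lead_coeff (h k) = (\<Sum>i<k. r i * lead_coeff (h i))" "range r \<subseteq> R"
    by (auto simp: lincomb_def)
  let ?d = "degree (h k)"
  \<comment> \<open>\<open>h k\<close> was already a candidate at stage \<open>i\<close>.\<close>
  have deg: "degree (h i) \<le> ?d" if "i < k" for i
    using h[of i] h[of k] lincomb_mono[OF R', of i k h] that by (auto simp: P_def)
  \<comment> \<open>The monomials raise every \<open>h i\<close> to degree \<open>?d\<close>, so
    that \<open>t\<close> has the leading coefficient of \<open>h k\<close> there. Subtracting
    \<open>t\<close> stays in \<open>I\<close> and outside the ideal of the earlier
    \<open>h i\<close>.\<close>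
  define t where "t = (\<Sum>i<k. monom (r i) (?d - degree (h i)) * h i)"
  have monom: "monom (r i) e \<in> polys_over R" for i e
    using r(2) by (auto simp: polys_over_def is_subring_closed[OF R])
  have tL: "t \<in> ?L h k"
    unfolding t_def using monom
    by (intro lincomb_sum[OF R'] lincomb_mult[OF R'] lincomb_base[OF R']) auto
  obtain K where K: "\<forall>i<Suc k. h i \<in> ?L q K"
    using I_union[of "Suc k" h] h by (auto simp: P_def)
  have "t \<in> ?L q K" using tL lincomb_trans[OF R', of k h q K] K by auto
  then have "h k + (- 1) * t \<in> ?L q K"
    using K by (intro lincomb_add[OF R'] lincomb_mult[OF R'] is_subring_closed[OF R']) auto
  then have I': "h k - t \<in> I" by (auto simp: I_def)
  have L': "h k - t \<notin> ?L h k"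
  proof
    assume "h k - t \<in> ?L h k"
    from lincomb_add[OF R' this tL] show False using h[of k] by (simp add: P_def)
  qed
  have "degree t \<le> ?d" unfolding t_def
  proof (intro degree_sum_le)
    fix i assume "i \<in> {..<k}"
    then have "degree (h i) \<le> ?d" using deg by auto
    then show "degree (monom (r i) (?d - degree (h i)) * h i) \<le> ?d"
      using degree_mult_le[of "monom (r i) (?d - degree (h i))" "h i"]
        degree_monom_le[of "r i" "?d - degree (h i)"] by linarith
  qed simp
  then have deg': "degree (h k - t) \<le> ?d" by (intro degree_diff_le) auto
  have "poly.coeff t ?d = (\<Sum>i<k. r i * lead_coeff (h i))"
    unfolding t_def coeff_sum
  proof (intro sum.cong refl)
    fix i assume "i \<in> {..<k}"
    then have "degree (h i) \<le> ?d" using deg by auto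
    then show "poly.coeff (monom (r i) (?d - degree (h i)) * h i) ?d = r i * lead_coeff (h i)"
      by (simp add: coeff_monom_mult)
  qed
  then have "poly.coeff (h k - t) ?d = 0" using r by simp
  moreover have "h k - t \<noteq> 0" using L' lincomb_zero[OF R'] by metis
  ultimately have "degree (h k - t) \<noteq> ?d" by (metis leading_coeff_0_iff)
  with deg' have "degree (h k - t) < ?d" by simp
  then show False using h[of k] I' L' unfolding P_def by fastforce
qed

text \<open>Lift the sequence along evaluation at \<open>x\<close>, find a relation among the
  polynomials, and evaluate it.\<close>

lemma noetherian_on_adjoin:
  assumes R: "is_subring R" and noetherian_on: "noetherian_on R"
  shows "noetherian_on (adjoin R x)"
  unfolding noetherian_on_def
proof (intro allI impI)
  fix f :: "nat \<Rightarrow> 'a" assume "range f \<subseteq> adjoin R x"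
  then have "\<forall>k. \<exists>q. q \<in> polys_over R \<and> f k = poly q x" unfolding adjoin_def by blast
  then obtain q where q: "\<And>k. q k \<in> polys_over R" "\<And>k. f k = poly (q k) x" by metis
  then obtain k r where "q k = (\<Sum>i<k. r i * q i)" "range r \<subseteq> polys_over R"
    using noetherian_on_polys_over[OF assms] unfolding noetherian_on_def lincomb_def by blast
  then show "\<exists>k. f k \<in> lincomb (adjoin R x) f k"
    unfolding lincomb_def adjoin_def
    by (intro exI[of _ k] CollectI exI[of _ "\<lambda>i. poly (r i) x"]) (auto simp: q(2) poly_sum)
qed

lemma noetherian_on_range_Const: "noetherian_on (range (Const :: 'a::field \<Rightarrow> ('v, 'a) mpol))"
  unfolding noetherian_on_def
proof (intro allI impI)
  fix f :: "nat \<Rightarrow> ('v, 'a) mpol" assume "range f \<subseteq> range Const"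
  then have "\<forall>k. \<exists>c. f k = Const c" by blast
  then obtain c where c: "\<And>k. f k = Const (c k)" by metis
  show "\<exists>k. f k \<in> lincomb (range Const) f k"
  proof (cases "c 0 = 0")
    case True
    then show ?thesis by (intro exI[of _ 0]) (auto simp: lincomb_def c Const_hom)
  next
    case False
    then have "Const (c 1) = (\<Sum>i<1. Const (c 1 / c 0) * (Const (c i) :: ('v, 'a) mpol))"
      by (simp flip: Const_hom)
    then show ?thesis
      by (intro exI[of _ 1]) (auto simp: lincomb_def c intro!: exI[of _ "\<lambda>_. Const (c 1 / c 0)"])
  qed
qed

lemma is_subring_range_Const: "is_subring (range (Const :: 'a::field \<Rightarrow> ('v, 'a) mpol))"
  unfolding is_subring_def
proof (intro conjI ballI)
  show "0 \<in> range (Const :: 'a \<Rightarrow> ('v, 'a) mpol)" "1 \<in> range (Const :: 'a \<Rightarrow> ('v, 'a) mpol)"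
    by (metis Const_hom(1) rangeI, metis Const_hom(2) rangeI)
  fix a :: "('v, 'a) mpol" assume "a \<in> range Const"
  then obtain c where c: "a = Const c" by blast
  show "- a \<in> range Const" using c by (auto simp: Const_def single_uminus[symmetric])
  fix b :: "('v, 'a) mpol" assume "b \<in> range Const"
  then show "a + b \<in> range Const" "a * b \<in> range Const" using c by (auto simp flip: Const_hom)
qed

text \<open>The ring constructed is the polynomial ring in the variables of \<open>V\<close>,
  obtained by adjoining one at a time; its later use rests on these four properties.\<close>

theorem hilbert_basis_mpol:
  assumes "finite V"
  shows "\<exists>R :: ('v, 'a::field) mpol set. is_subring R \<and> noetherian_on R \<and> range Const \<subseteq> R \<and> Var ` V \<subseteq> R"
  using assms
proof (induction V)
  case empty
  show ?case using noetherian_on_range_Const is_subring_range_Const by (intro exI[of _ "range Const"]) auto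
next
  case (insert v V)
  then obtain R :: "('v, 'a) mpol set" where
    R: "is_subring R" "noetherian_on R" "range Const \<subseteq> R" "Var ` V \<subseteq> R" by blast
  then show ?case
    using is_subring_adjoin[of R "Var v"] noetherian_on_adjoin[of R "Var v"] adjoin_base[of R "Var v"]
    by (intro exI[of _ "adjoin R (Var v)"]) auto
qed


section \<open>Locally dependent matrices\<close>

text \<open>
  Finitely supported sequences \<^typ>\<open>nat \<Rightarrow>\<^sub>0 'a\<close> act as linear functionals on the space of all
  sequences.
\<close>

definition sscale :: "'a::field \<Rightarrow> (nat \<Rightarrow> 'a) \<Rightarrow> nat \<Rightarrow> 'a" where
  "sscale c v = (\<lambda>i. c * v i)"

interpretation seqs: vector_space sscale
  by unfold_locales (auto simp: sscale_def fun_eq_iff algebra_simps)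

definition pscale :: "'a::field \<Rightarrow> (nat \<Rightarrow>\<^sub>0 'a) \<Rightarrow> nat \<Rightarrow>\<^sub>0 'a" where
  "pscale c u = Poly_Mapping.map ((*) c) u"

definition pair :: "(nat \<Rightarrow>\<^sub>0 'a::field) \<Rightarrow> (nat \<Rightarrow> 'a) \<Rightarrow> 'a" where
  "pair u v = (\<Sum>i\<in>Poly_Mapping.keys u. Poly_Mapping.lookup u i * v i)"

section \<open>The pairing of finitely supported sequences with arbitrary ones\<close>

lemma lookup_pscale [simp]: "Poly_Mapping.lookup (pscale c u) i = c * Poly_Mapping.lookup u i"
  by (auto simp: pscale_def Poly_Mapping.map.rep_eq when_def)

lemma pair_superset:
  assumes "finite L" "Poly_Mapping.keys u \<subseteq> L"
  shows "pair u v = (\<Sum>i\<in>L. Poly_Mapping.lookup u i * v i)"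
  unfolding pair_def using assms by (intro sum.mono_neutral_left) (auto simp: in_keys_iff)

lemma pair_zero_left [simp]: "pair 0 v = 0"
  by (simp add: pair_def)

lemma pair_add_left: "pair (u + u') v = pair u v + pair u' v"
proof -
  let ?L = "Poly_Mapping.keys u \<union> Poly_Mapping.keys u'"
  show ?thesis
    using keys_add[of u u']
    by (simp add: pair_superset[of ?L] lookup_add distrib_right sum.distrib)
qed

lemma pair_pscale_left: "pair (pscale c u) v = c * pair u v"
proof -
  have "Poly_Mapping.keys (pscale c u) \<subseteq> Poly_Mapping.keys u" by (auto simp: in_keys_iff)
  then show ?thesis
    by (simp add: pair_superset[of "Poly_Mapping.keys u"] sum_distrib_left mult.assoc)
qed

lemma pair_diff_left: "pair (u - u') v = pair u v - pair u' v"
proof -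
  have "pair u v = pair (u - u') v + pair u' v" by (simp flip: pair_add_left)
  then show ?thesis by simp
qed

lemma pair_sum_left: "pair (sum u I) v = (\<Sum>i\<in>I. pair (u i) v)"
  by (induction I rule: infinite_finite_induct) (auto simp: pair_add_left)

lemma pair_single [simp]: "pair (Poly_Mapping.single i c) v = c * v i"
  by (simp add: pair_superset[of "{i}"])

lemma pair_add_right: "pair u (v + v') = pair u v + pair u v'"
  by (simp add: pair_def distrib_left sum.distrib)

lemma pair_sscale_right: "pair u (sscale c v) = c * pair u v"
  by (simp add: pair_def sscale_def sum_distrib_left mult_ac)

lemma pair_sum_right: "pair u (sum v I) = (\<Sum>i\<in>I. pair u (v i))"
proof (induction I rule: infinite_finite_induct)
  case (insert i I)
  then show ?case unfolding sum.insert[OF insert.hyps(1,2)] pair_add_right by simp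
qed (simp_all add: pair_def)

lemma sum_sscale_apply: "(\<Sum>i\<in>I. sscale (c i) (v i)) j = (\<Sum>i\<in>I. c i * v i j)"
  by (induction I rule: infinite_finite_induct) (auto simp: sscale_def)

section \<open>Separating functionals, dual families and perturbed independence\<close>

lemma pair_span_eq_0:
  assumes "v \<in> seqs.span D" "\<And>d. d \<in> D \<Longrightarrow> pair w d = 0"
  shows "pair w v = 0"
  using assms(1)
proof (induction rule: seqs.span_induct_alt)
  case (step c x y)
  then show ?case unfolding pair_add_right pair_sscale_right using assms(2) by simp
qed (simp add: pair_def)

text \<open>Finite-dimensional subspaces are cut out by finitely supported functionals. In the
  induction, a functional for a shifted \<open>v\<close> is corrected by a multiple of one that is
  \<open>1\<close> on \<open>d\<close> and \<open>0\<close> on \<open>D\<close>.\<close>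

lemma separating_functional:
  assumes "finite D" "v \<notin> seqs.span D"
  shows "\<exists>w. (\<forall>d\<in>D. pair w d = 0) \<and> pair w v = 1"
  using assms
proof (induction D arbitrary: v)
  case empty
  then have "v \<noteq> 0" by simp
  then obtain j where "v j \<noteq> 0" by (auto simp: fun_eq_iff)
  then show ?case by (intro exI[of _ "Poly_Mapping.single j (1 / v j)"]) simp
next
  case (insert d D)
  have v: "v - sscale c d \<notin> seqs.span D" for c
    using insert.prems by (auto simp: seqs.span_breakdown_eq)
  show ?case
  proof (cases "d \<in> seqs.span D")
    case True
    have "v \<notin> seqs.span D" using v[of 0] by simp
    from insert.IH[OF this] obtain w where w: "\<forall>d\<in>D. pair w d = 0" "pair w v = 1" by blast
    have "pair w d = 0" by (rule pair_span_eq_0[OF True]) (use w in blast)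
    then show ?thesis using w by blast
  next
    case False
    from insert.IH[OF this] obtain w2 where w2: "\<forall>d\<in>D. pair w2 d = 0" "pair w2 d = 1" by blast
    \<comment> \<open>The shift is chosen so that \<open>w2\<close> vanishes on the shifted vector.
      Subtracting \<open>pair w3 d\<close> times \<open>w2\<close> from \<open>w3\<close> then kills
      \<open>d\<close> and gives the value \<open>1\<close> at \<open>v\<close>.\<close>
    from insert.IH[OF v] obtain w3 where w3: "\<forall>d\<in>D. pair w3 d = 0" "pair w3 (v - sscale (pair w2 v) d) = 1"
      by blast
    have "pair w3 v = pair w3 ((v - sscale (pair w2 v) d) + sscale (pair w2 v) d)"
      by (simp only: diff_add_cancel)
    also have "\<dots> = 1 + pair w2 v * pair w3 d"
      by (simp only: pair_add_right w3(2) pair_sscale_right)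
    finally show ?thesis
      using w2 w3(1)
      by (intro exI[of _ "w3 - pscale (pair w3 d) w2"]) (auto simp: pair_diff_left pair_pscale_left)
  qed
qed

text \<open>Linear independence in the quotient by \<open>S\<close>, for a family instead of a set:
  repeated vectors count as dependent.\<close>

definition indep_mod :: "'i set \<Rightarrow> ('i \<Rightarrow> nat \<Rightarrow> 'a::field) \<Rightarrow> (nat \<Rightarrow> 'a) set \<Rightarrow> bool" where
  "indep_mod J f S \<longleftrightarrow> (\<forall>c. (\<Sum>j\<in>J. sscale (c j) (f j)) \<in> S \<longrightarrow> (\<forall>j\<in>J. c j = 0))"

lemma span_Un_image:
  assumes "finite K" "x \<in> seqs.span (D \<union> f ` K)"
  shows "\<exists>c. x - (\<Sum>i\<in>K. sscale (c i) (f i)) \<in> seqs.span D"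
  using assms
proof (induction K arbitrary: x)
  case (insert k K)
  then obtain e where "x - sscale e (f k) \<in> seqs.span (D \<union> f ` K)"
    by (auto simp: seqs.span_breakdown_eq)
  then obtain c where c: "x - sscale e (f k) - (\<Sum>i\<in>K. sscale (c i) (f i)) \<in> seqs.span D"
    using insert.IH by blast
  have "(\<Sum>i\<in>K. sscale ((c(k := e)) i) (f i)) = (\<Sum>i\<in>K. sscale (c i) (f i))"
    using insert.hyps by (intro sum.cong) auto
  then have "x - (\<Sum>i\<in>insert k K. sscale ((c(k := e)) i) (f i)) \<in> seqs.span D"
    using c insert.hyps by (simp add: diff_diff_eq)
  then show ?case by blast
qed auto

text \<open>Each \<open>f j\<close> lies outside the span of \<open>D\<close> and the other members;
  a functional separating it from them is the dual one.\<close>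

lemma dual_family:
  assumes "finite J" "finite D" "indep_mod J f (seqs.span D)"
  shows "\<exists>w. \<forall>j\<in>J. (\<forall>d\<in>D. pair (w j) d = 0) \<and> (\<forall>i\<in>J. pair (w j) (f i) = (if i = j then 1 else 0))"
proof -
  have "\<exists>w. (\<forall>d\<in>D. pair w d = 0) \<and> (\<forall>i\<in>J. pair w (f i) = (if i = j then 1 else 0))" if "j \<in> J" for j
  proof -
    have "f j \<notin> seqs.span (D \<union> f ` (J - {j}))"
    proof
      assume "f j \<in> seqs.span (D \<union> f ` (J - {j}))"
      then obtain c where c: "f j - (\<Sum>i\<in>J - {j}. sscale (c i) (f i)) \<in> seqs.span D"
        using span_Un_image[of "J - {j}"] assms(1) by blast
      \<comment> \<open>The coefficient \<open>1\<close> at \<open>j\<close> makes this a relation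
        modulo \<open>D\<close> that independence forbids.\<close>
      define e where "e i = (if i = j then 1 else - c i)" for i
      have "(\<Sum>i\<in>J. sscale (e i) (f i)) = sscale 1 (f j) + (\<Sum>i\<in>J - {j}. sscale (e i) (f i))"
        using assms(1) that by (subst sum.remove[of _ j]) (auto simp: e_def)
      also have "(\<Sum>i\<in>J - {j}. sscale (e i) (f i)) = - (\<Sum>i\<in>J - {j}. sscale (c i) (f i))"
        unfolding sum_negf[symmetric] by (intro sum.cong) (auto simp: e_def)
      finally have "(\<Sum>i\<in>J. sscale (e i) (f i)) = f j - (\<Sum>i\<in>J - {j}. sscale (c i) (f i))"
        unfolding seqs.scale_one by (simp only: diff_conv_add_uminus)
      then have "(\<Sum>i\<in>J. sscale (e i) (f i)) \<in> seqs.span D" using c by simp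
      then have "e j = 0" using assms(3) that unfolding indep_mod_def by blast
      then show False by (simp add: e_def)
    qed
    then obtain w where "\<forall>d\<in>D \<union> f ` (J - {j}). pair w d = 0" "pair w (f j) = 1"
      using separating_functional[of "D \<union> f ` (J - {j})" "f j"] assms by auto
    then show ?thesis by (intro exI[of _ w]) auto
  qed
  then show ?thesis by metis
qed

text \<open>
  In coordinates dual to \<open>a\<close>, a dependency among the \<open>a j + t b j\<close> is an eigenvector for the
  eigenvalue \<open>- 1 / t\<close>.
\<close>

lemma finite_dependent_perturbations:
  assumes "finite J" "finite D" "indep_mod J a (seqs.span D)"
  shows "finite {t. \<not> indep_mod J (\<lambda>j. a j + sscale t (b j)) (seqs.span D)}"
proof -
  obtain w where w: "\<forall>j\<in>J. (\<forall>d\<in>D. pair (w j) d = 0) \<and>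
      (\<forall>i\<in>J. pair (w j) (a i) = (if i = j then 1 else 0))"
    using dual_family[OF assms] by blast
  let ?q = "card J"
  obtain h where h: "bij_betw h {..<?q} J"
    using ex_bij_betw_nat_finite[OF assms(1)] by (auto simp: atLeast0LessThan)
  \<comment> \<open>The matrix of the \<open>b j\<close> in the coordinates given by the dual
    functionals \<open>w\<close>.\<close>
  define B where "B = mat ?q ?q (\<lambda>(i, j). pair (w (h i)) (b (h j)))"
  have B: "B \<in> carrier_mat ?q ?q" by (simp add: B_def)
  \<comment> \<open>\<open>0\<close> is listed separately because \<open>- 1 / t\<close> is only
    meaningful for the other \<open>t\<close>.\<close>
  have "t \<in> insert 0 ((\<lambda>k. - 1 / k) ` {k. poly (char_poly B) k = 0})"
    if "\<not> indep_mod J (\<lambda>j. a j + sscale t (b j)) (seqs.span D)" for t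
  proof (cases "t = 0")
    case False
    obtain c j where c: "(\<Sum>j\<in>J. sscale (c j) (a j + sscale t (b j))) \<in> seqs.span D"
      and j: "j \<in> J" "c j \<noteq> 0"
      using \<open>\<not> indep_mod _ _ _\<close> unfolding indep_mod_def by blast
    \<comment> \<open>Applying \<open>w i\<close> to the relation gives zero, since
      \<open>w i\<close> vanishes on the span of \<open>D\<close>. Up to the numbering
      \<open>h\<close>, this is one coordinate of \<open>c + t B c = 0\<close>.\<close>
    have *: "c i + t * (\<Sum>j\<in>J. c j * pair (w i) (b j)) = 0" if "i \<in> J" for i
    proof -
      have "0 = pair (w i) (\<Sum>j\<in>J. sscale (c j) (a j + sscale t (b j)))"
        using pair_span_eq_0[OF c] w that by metis
      also have "\<dots> = (\<Sum>j\<in>J. c j * (pair (w i) (a j) + t * pair (w i) (b j)))"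
        by (simp only: pair_sum_right pair_sscale_right pair_add_right)
      also have "\<dots> = (\<Sum>j\<in>J. (if j = i then c j else 0)) + (\<Sum>j\<in>J. t * (c j * pair (w i) (b j)))"
        unfolding sum.distrib[symmetric] using w that by (intro sum.cong) (auto simp: algebra_simps)
      finally show ?thesis using that assms(1) by (simp add: sum_distrib_left)
    qed
    define x where "x = vec ?q (\<lambda>i. c (h i))"
    have "j \<in> h ` {..<?q}" using h j(1) by (simp add: bij_betw_def)
    then obtain j' where j': "j' < ?q" "h j' = j" by blast
    have "x \<noteq> 0\<^sub>v ?q"
    proof
      assume "x = 0\<^sub>v ?q"
      then have "x $ j' = 0" using j' by simp
      then show False using j j' by (simp add: x_def)
    qed
    moreover have "B *\<^sub>v x = (- 1 / t) \<cdot>\<^sub>v x"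
    proof (rule eq_vecI)
      fix i assume "i < dim_vec ((- 1 / t) \<cdot>\<^sub>v x)"
      then have i: "i < ?q" by (simp add: x_def)
      then have hi: "h i \<in> J" using h by (auto simp: bij_betw_def)
      have "(B *\<^sub>v x) $ i = (\<Sum>j\<in>{..<?q}. c (h j) * pair (w (h i)) (b (h j)))"
        using i by (auto simp: B_def x_def scalar_prod_def atLeast0LessThan mult_ac intro!: sum.cong)
      also have "\<dots> = (\<Sum>j\<in>J. c j * pair (w (h i)) (b j))"
        by (rule sum.reindex_bij_betw[OF h])
      also have "\<dots> = (- 1 / t) * c (h i)"
        using *[OF hi] False by (simp add: field_simps eq_neg_iff_add_eq_0 add.commute)
      finally show "(B *\<^sub>v x) $ i = ((- 1 / t) \<cdot>\<^sub>v x) $ i" using i by (simp add: x_def)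
    qed (simp add: B_def x_def)
    ultimately have "eigenvalue B (- 1 / t)"
      unfolding eigenvalue_def eigenvector_def by (intro exI[of _ x]) (auto simp: x_def B_def)
    then have "poly (char_poly B) (- 1 / t) = 0" using eigenvalue_root_char_poly[OF B] by simp
    moreover have "t = - 1 / (- 1 / t)" by simp
    ultimately show ?thesis by blast
  qed simp
  then have sub: "{t. \<not> indep_mod J (\<lambda>j. a j + sscale t (b j)) (seqs.span D)}
      \<subseteq> insert 0 ((\<lambda>k. - 1 / k) ` {k. poly (char_poly B) k = 0})" by blast
  have "char_poly B \<noteq> 0" using degree_monic_char_poly[OF B] by auto
  then have "finite {k. poly (char_poly B) k = 0}" by (rule poly_roots_finite)
  then show ?thesis by (intro finite_subset[OF sub] finite.insertI finite_imageI)
qed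

section \<open>Row combinations of matrices, local linear dependence and bounded rank\<close>

definition annihilator :: "(nat \<Rightarrow> 'a::field) set \<Rightarrow> (nat \<Rightarrow>\<^sub>0 'a) set" where
  "annihilator Z = {u. \<forall>z\<in>Z. pair u z = 0}"

text \<open>The product \<open>u M\<close> with \<open>u\<close> as a row vector; finite support
  makes it defined for every \<open>M\<close>.\<close>

definition rowcomb :: "(nat \<Rightarrow>\<^sub>0 'a::field) \<Rightarrow> 'a imat \<Rightarrow> nat \<Rightarrow> 'a" where
  "rowcomb u M = (\<lambda>j. pair u (\<lambda>i. M i j))"

lemma rowcomb_add: "rowcomb (u + u') M = rowcomb u M + rowcomb u' M"
  by (simp add: rowcomb_def fun_eq_iff pair_add_left)

lemma rowcomb_pscale: "rowcomb (pscale c u) M = sscale c (rowcomb u M)"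
  by (simp add: rowcomb_def fun_eq_iff pair_pscale_left sscale_def)

lemma rowcomb_single [simp]: "rowcomb (Poly_Mapping.single i 1) M = M i"
  by (simp add: rowcomb_def)

lemma rowcomb_lincomb:
  "rowcomb u (\<lambda>i j. \<Sum>k\<in>K. c k * M k i j) = (\<Sum>k\<in>K. sscale (c k) (rowcomb u (M k)))"
proof
  fix j
  have "rowcomb u (\<lambda>i j. \<Sum>k\<in>K. c k * M k i j) j = pair u (\<Sum>k\<in>K. sscale (c k) (\<lambda>i. M k i j))"
    by (auto simp: rowcomb_def sum_sscale_apply intro!: arg_cong[of _ _ "pair u"])
  then show "rowcomb u (\<lambda>i j. \<Sum>k\<in>K. c k * M k i j) j =
      (\<Sum>k\<in>K. sscale (c k) (rowcomb u (M k))) j"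
    by (simp add: pair_sum_right pair_sscale_right sum_sscale_apply rowcomb_def)
qed

lemma annihilator_closed:
  "0 \<in> annihilator Z" "u \<in> annihilator Z \<Longrightarrow> u' \<in> annihilator Z \<Longrightarrow> u + u' \<in> annihilator Z"
  "u \<in> annihilator Z \<Longrightarrow> pscale c u \<in> annihilator Z"
  by (auto simp: annihilator_def pair_add_left pair_pscale_left)

text \<open>
  Take \<open>u0\<close> and \<open>S\<close> such that the \<open>u0 M\<^sub>k\<close>, \<open>k \<in> S\<close>, are independent with \<open>S\<close> maximal, and a
  combination \<open>T\<close> with \<open>u0 T\<close> in the span of \<open>D\<close>. The maximality of \<open>S\<close> at \<open>u0 + t u\<close> makes \<open>u T\<close>
  dependent on the \<open>(u0 + t u) M\<^sub>k\<close> for all \<open>t \<noteq> 0\<close>, hence also for \<open>t = 0\<close>.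
\<close>

lemma locally_dependent_lincomb:
  fixes M :: "nat \<Rightarrow> 'a::field imat"
  assumes inf: "infinite (UNIV :: 'a set)" and D: "finite D"
    and dep: "\<And>u. u \<in> annihilator Z \<Longrightarrow> \<not> indep_mod {..<p} (\<lambda>k. rowcomb u (M k)) (seqs.span D)"
  shows "\<exists>c D'. (\<exists>l<p. c l \<noteq> 0) \<and> finite D' \<and> card D' \<le> card D + p \<and>
    (\<forall>u\<in>annihilator Z. rowcomb u (\<lambda>i j. \<Sum>k<p. c k * M k i j) \<in> seqs.span D')"
proof -
  \<comment> \<open>The index sets that are independent at some admissible \<open>u\<close>;
    \<open>S\<close> below is a maximal one.\<close>
  define A where "A = {S. S \<subseteq> {..<p} \<and>
    (\<exists>u\<in>annihilator Z. indep_mod S (\<lambda>k. rowcomb u (M k)) (seqs.span D))}"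
  have "finite A" by (rule finite_subset[of _ "Pow {..<p}"]) (auto simp: A_def)
  moreover have "{} \<in> A" using annihilator_closed(1) by (auto simp: A_def indep_mod_def)
  ultimately obtain S where S: "S \<in> A" "\<And>S'. S' \<in> A \<Longrightarrow> S \<subseteq> S' \<Longrightarrow> S = S'"
    using finite_has_maximal2[of A "{}"] by metis
  then obtain u0 where u0: "u0 \<in> annihilator Z"
    "indep_mod S (\<lambda>k. rowcomb u0 (M k)) (seqs.span D)" and Sp: "S \<subseteq> {..<p}"
    by (auto simp: A_def)
  have "S \<noteq> {..<p}" using u0 dep by metis
  then obtain l where l: "l < p" "l \<notin> S" using Sp by auto
  have fin: "finite S" using Sp finite_subset by blast
  have dep': "\<not> indep_mod (insert l S) (\<lambda>k. rowcomb u (M k)) (seqs.span D)"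
    if "u \<in> annihilator Z" for u
  proof
    assume "indep_mod (insert l S) (\<lambda>k. rowcomb u (M k)) (seqs.span D)"
    then have "insert l S \<in> A" using that l Sp by (auto simp: A_def)
    then show False using S(2)[of "insert l S"] l by auto
  qed
  \<comment> \<open>The \<open>u0 M k\<close> with \<open>k\<close> in \<open>S\<close> are
    independent modulo \<open>D\<close>, so every relation between them and one more vector, placed
    at index \<open>l\<close>, involves that vector.\<close>
  have last: "g l \<noteq> 0"
    if "(\<Sum>k\<in>insert l S. sscale (g k) (a k)) \<in> seqs.span D" "\<exists>k\<in>insert l S. g k \<noteq> 0"
      "\<And>k. k \<in> S \<Longrightarrow> a k = rowcomb u0 (M k)" for g a
  proof
    assume "g l = 0"
    moreover have "(\<Sum>k\<in>S. sscale (g k) (a k)) = (\<Sum>k\<in>S. sscale (g k) (rowcomb u0 (M k)))"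
      using that(3) by (intro sum.cong) auto
    ultimately have "(\<Sum>k\<in>S. sscale (g k) (rowcomb u0 (M k))) \<in> seqs.span D"
      using that(1) l(2) fin by simp
    then have "\<forall>k\<in>S. g k = 0" using u0(2) unfolding indep_mod_def by blast
    then show False using \<open>g l = 0\<close> that(2) by blast
  qed
  obtain c where c: "(\<Sum>k\<in>insert l S. sscale (c k) (rowcomb u0 (M k))) \<in> seqs.span D"
    "\<exists>k\<in>insert l S. c k \<noteq> 0"
    using dep'[OF u0(1)] unfolding indep_mod_def by blast
  have cl: "c l \<noteq> 0" by (rule last[OF c]) simp
  \<comment> \<open>Extends \<open>c\<close> by zero to all indices below \<open>p\<close>. By the
    choice of \<open>c\<close>, the row \<open>u0 T\<close> lies in the span of
    \<open>D\<close>.\<close>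
  define c' where "c' k = (if k \<in> insert l S then c k else 0)" for k
  define T where "T = (\<lambda>i j. \<Sum>k<p. c' k * M k i j)"
  have T: "rowcomb u T = (\<Sum>k\<in>insert l S. sscale (c k) (rowcomb u (M k)))" for u
  proof -
    have "rowcomb u T = (\<Sum>k<p. sscale (c' k) (rowcomb u (M k)))"
      unfolding T_def by (rule rowcomb_lincomb)
    also have "\<dots> = (\<Sum>k\<in>insert l S. sscale (c' k) (rowcomb u (M k)))"
      using Sp l by (intro sum.mono_neutral_right) (auto simp: c'_def sscale_def fun_eq_iff)
    also have "\<dots> = (\<Sum>k\<in>insert l S. sscale (c k) (rowcomb u (M k)))"
      by (intro sum.cong) (auto simp: c'_def)
    finally show ?thesis .
  qed
  let ?D' = "D \<union> (\<lambda>k. rowcomb u0 (M k)) ` S"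
  have "rowcomb u T \<in> seqs.span ?D'" if u: "u \<in> annihilator Z" for u
  proof -
    \<comment> \<open>\<open>a + t b\<close> consists of \<open>u T\<close> at \<open>l\<close> and
      of \<open>(u0 + t u) M k\<close> at the \<open>k\<close> in \<open>S\<close>.\<close>
    define a where "a k = (if k = l then rowcomb u T else rowcomb u0 (M k))" for k
    define b where "b k = (if k = l then 0 else rowcomb u (M k))" for k
    have "\<not> indep_mod (insert l S) (\<lambda>k. a k + sscale t (b k)) (seqs.span D)" if t: "t \<noteq> 0" for t
    proof -
      let ?u = "u0 + pscale t u"
      have "?u \<in> annihilator Z" using u u0(1) by (intro annihilator_closed)
      from dep'[OF this] obtain e k where
        e: "(\<Sum>k\<in>insert l S. sscale (e k) (rowcomb ?u (M k))) \<in> seqs.span D"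
        and k: "k \<in> insert l S" "e k \<noteq> 0"
        unfolding indep_mod_def by blast
      \<comment> \<open>Eliminates \<open>M l\<close> from the relation \<open>e\<close>: subtract
        \<open>e l / c l\<close> times \<open>(u0 + t u) T\<close> and keep its part in
        \<open>u T\<close> as the entry at \<open>l\<close>. The part in \<open>u0 T\<close> lies in
        the span of \<open>D\<close>.\<close>
      define e' where "e' k = (if k = l then t * e l / c l else e k - e l * c k / c l)" for k
      have nz: "\<exists>k\<in>insert l S. e' k \<noteq> 0"
      proof (cases "e l = 0")
        case True
        then show ?thesis using k by (auto simp: e'_def intro!: bexI[of _ k])
      next
        case False
        then show ?thesis using t cl by (auto simp: e'_def)
      qed
      have "(\<Sum>k\<in>insert l S. sscale (e' k) (a k + sscale t (b k))) =
        sscale (e' l) (a l + sscale t (b l)) + (\<Sum>k\<in>S. sscale (e' k) (a k + sscale t (b k)))"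
        using fin l(2) by simp
      also have "sscale (e' l) (a l + sscale t (b l)) = sscale (t * e l / c l) (rowcomb u T)"
        by (simp add: a_def b_def e'_def)
      also have "(\<Sum>k\<in>S. sscale (e' k) (a k + sscale t (b k))) =
        (\<Sum>k\<in>S. sscale (e k) (rowcomb ?u (M k)) - sscale (e l / c l) (sscale (c k) (rowcomb ?u (M k))))"
      proof (intro sum.cong refl)
        fix k assume "k \<in> S"
        then have "k \<noteq> l" using l(2) by blast
        then show "sscale (e' k) (a k + sscale t (b k)) =
            sscale (e k) (rowcomb ?u (M k)) - sscale (e l / c l) (sscale (c k) (rowcomb ?u (M k)))"
          by (simp add: a_def b_def e'_def rowcomb_add rowcomb_pscale seqs.scale_left_diff_distrib)
      qed
      also have "(\<Sum>k\<in>S. sscale (e k) (rowcomb ?u (M k)) - sscale (e l / c l) (sscale (c k) (rowcomb ?u (M k)))) =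
        (\<Sum>k\<in>insert l S. sscale (e k) (rowcomb ?u (M k))) - sscale (e l / c l) (rowcomb ?u T)"
        using fin l(2) cl
        by (simp add: T sum_subtractf seqs.scale_sum_right seqs.scale_right_distrib)
      also have "sscale (t * e l / c l) (rowcomb u T) +
          ((\<Sum>k\<in>insert l S. sscale (e k) (rowcomb ?u (M k))) - sscale (e l / c l) (rowcomb ?u T)) =
        (\<Sum>k\<in>insert l S. sscale (e k) (rowcomb ?u (M k))) - sscale (e l / c l) (rowcomb u0 T)"
        by (simp add: rowcomb_add rowcomb_pscale seqs.scale_right_distrib mult_ac)
      also have "\<dots> \<in> seqs.span D"
        using e c(1) unfolding T by (intro seqs.span_diff seqs.span_scale)
      finally show ?thesis using nz unfolding indep_mod_def by blast
    qed
    \<comment> \<open>Infinitely many dependent values of \<open>t\<close> exclude independence at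
      \<open>t = 0\<close>, that is, of \<open>a\<close>.\<close>
    then have "UNIV - {0} \<subseteq> {t. \<not> indep_mod (insert l S) (\<lambda>k. a k + sscale t (b k)) (seqs.span D)}"
      by auto
    moreover have "infinite (UNIV - {0 :: 'a})" using inf by simp
    ultimately have "\<not> indep_mod (insert l S) a (seqs.span D)"
      using finite_dependent_perturbations[of "insert l S" D a b] fin D by (meson finite_insert finite_subset)
    then obtain g where g: "(\<Sum>k\<in>insert l S. sscale (g k) (a k)) \<in> seqs.span D"
      "\<exists>k\<in>insert l S. g k \<noteq> 0"
      unfolding indep_mod_def by blast
    have gl: "g l \<noteq> 0" by (rule last[OF g]) (use l(2) in \<open>auto simp: a_def\<close>)
    have "(\<Sum>k\<in>insert l S. sscale (g k) (a k)) =
        sscale (g l) (rowcomb u T) + (\<Sum>k\<in>S. sscale (g k) (a k))"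
      using fin l(2) by (simp add: a_def)
    then have "sscale (g l) (rowcomb u T) =
        (\<Sum>k\<in>insert l S. sscale (g k) (a k)) - (\<Sum>k\<in>S. sscale (g k) (a k))" by simp
    also have "\<dots> \<in> seqs.span ?D'"
    proof (rule seqs.span_diff)
      show "(\<Sum>k\<in>insert l S. sscale (g k) (a k)) \<in> seqs.span ?D'"
        using g(1) seqs.span_mono[of D ?D'] by blast
      have "a k \<in> ?D'" if "k \<in> S" for k using that l(2) by (auto simp: a_def)
      then show "(\<Sum>k\<in>S. sscale (g k) (a k)) \<in> seqs.span ?D'"
        by (intro seqs.span_sum seqs.span_scale seqs.span_base)
    qed
    finally have "sscale (1 / g l) (sscale (g l) (rowcomb u T)) \<in> seqs.span ?D'"
      by (rule seqs.span_scale)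
    then show ?thesis using gl by simp
  qed
  moreover have "card ?D' \<le> card D + p"
  proof -
    have "card ?D' \<le> card D + card ((\<lambda>k. rowcomb u0 (M k)) ` S)" by (rule card_Un_le)
    also have "card ((\<lambda>k. rowcomb u0 (M k)) ` S) \<le> card S" by (rule card_image_le[OF fin])
    also have "card S \<le> p" using card_mono[OF _ Sp] by simp
    finally show ?thesis by simp
  qed
  moreover have "c' l \<noteq> 0" using cl by (simp add: c'_def)
  ultimately show ?thesis
    using l(1) fin D unfolding T_def by (intro exI[of _ c'] exI[of _ ?D']) auto
qed

text \<open>Each vector \<open>z\<close> imposes one linear condition on \<open>u\<close>, so
  dropping it from \<open>Z\<close> costs at most one more spanning row.\<close>

lemma rowcomb_span_extend:
  assumes "finite Z" "finite D" "\<And>u. u \<in> annihilator Z \<Longrightarrow> rowcomb u T \<in> seqs.span D"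
  shows "\<exists>D'. finite D' \<and> card D' \<le> card D + card Z \<and> (\<forall>u. rowcomb u T \<in> seqs.span D')"
  using assms
proof (induction Z arbitrary: D)
  case empty
  then show ?case by (intro exI[of _ D]) (auto simp: annihilator_def)
next
  case (insert z Z)
  have "\<exists>D1. finite D1 \<and> card D1 \<le> Suc (card D) \<and> (\<forall>u\<in>annihilator Z. rowcomb u T \<in> seqs.span D1)"
  proof (cases "\<exists>g\<in>annihilator Z. pair g z \<noteq> 0")
    case False
    then show ?thesis using insert.prems
      by (intro exI[of _ D]) (auto simp: annihilator_def)
  next
    case True
    then obtain g where g: "g \<in> annihilator Z" "pair g z \<noteq> 0" by blast
    have "rowcomb u T \<in> seqs.span (insert (rowcomb g T) D)" if u: "u \<in> annihilator Z" for u
    proof -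
      \<comment> \<open>Subtracting this multiple of \<open>g\<close> makes \<open>u\<close> vanish
        on \<open>z\<close> as well.\<close>
      let ?c = "pair u z / pair g z"
      let ?u = "u + pscale (- ?c) g"
      have "?u \<in> annihilator (insert z Z)"
        using u g by (auto simp: annihilator_def pair_add_left pair_pscale_left)
      then have "rowcomb ?u T \<in> seqs.span D" by (rule insert.prems)
      then show ?thesis
        unfolding seqs.span_breakdown_eq
        by (intro exI[of _ ?c]) (simp add: rowcomb_add rowcomb_pscale)
    qed
    then show ?thesis using insert.prems(1)
      by (intro exI[of _ "insert (rowcomb g T) D"]) (auto simp: card_insert_if)
  qed
  then obtain D1 where D1: "finite D1" "card D1 \<le> Suc (card D)"
    "\<And>u. u \<in> annihilator Z \<Longrightarrow> rowcomb u T \<in> seqs.span D1" by blast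
  from insert.IH[OF D1(1,3)] obtain D' where "finite D'" "card D' \<le> card D1 + card Z"
    "\<forall>u. rowcomb u T \<in> seqs.span D'" by blast
  then show ?case using D1(2) insert.hyps by (intro exI[of _ D']) auto
qed

text \<open>Rank as a factorisation through \<open>k\<close> inner indices. The two factors later
  supply the additional columns of \<open>P\<close> and rows of \<open>Q\<close>.\<close>

definition rank_le :: "'a::field imat \<Rightarrow> nat \<Rightarrow> bool" where
  "rank_le T k \<longleftrightarrow> (\<exists>A B. \<forall>i j. T i j = (\<Sum>s<k. A i s * B s j))"

lemma rank_le_mono:
  assumes "rank_le T k" "k \<le> k'"
  shows "rank_le T k'"
proof -
  from assms(1) obtain A B where AB: "\<forall>i j. T i j = (\<Sum>s<k. A i s * B s j)"
    unfolding rank_le_def by blast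
  have "T i j = (\<Sum>s<k'. (if s < k then A i s else 0) * B s j)" for i j
    unfolding AB[rule_format] using assms(2) by (intro sum.mono_neutral_cong_left) auto
  then show ?thesis
    unfolding rank_le_def
    by (intro exI[of _ "\<lambda>i s. if s < k then A i s else 0"] exI[of _ B]) simp
qed

lemma rank_le_rows_in_span:
  assumes "finite D" "card D \<le> k" "\<And>i. T i \<in> seqs.span D"
  shows "rank_le T k"
proof -
  obtain h where h: "bij_betw h {..<card D} D"
    using ex_bij_betw_nat_finite[OF assms(1)] by (auto simp: atLeast0LessThan)
  have "\<forall>i. \<exists>g. T i = (\<Sum>v\<in>D. sscale (g v) v)"
    using assms(3) unfolding seqs.span_finite[OF assms(1)] by blast
  then obtain g where g: "\<And>i. T i = (\<Sum>v\<in>D. sscale (g i v) v)" by metis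
  \<comment> \<open>Positions from \<open>card D\<close> on are padded with coefficient
    \<open>0\<close>; there \<open>h s\<close> is arbitrary.\<close>
  have eq: "T i j = (\<Sum>s<k. (if s < card D then g i (h s) else 0) * h s j)" for i j
  proof -
    have "T i j = (\<Sum>v\<in>D. g i v * v j)" by (subst g) (rule sum_sscale_apply)
    also have "\<dots> = (\<Sum>s<card D. g i (h s) * h s j)"
      by (rule sum.reindex_bij_betw[OF h, symmetric])
    also have "\<dots> = (\<Sum>s<k. (if s < card D then g i (h s) else 0) * h s j)"
      using assms(2) by (intro sum.mono_neutral_cong_left) auto
    finally show ?thesis .
  qed
  show ?thesis
    unfolding rank_le_def
    by (rule exI[of _ "\<lambda>i s. if s < card D then g i (h s) else 0"], rule exI[of _ h])
       (intro allI eq)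
qed


section \<open>Row and column operations\<close>

text \<open>The operation that adds to each row in \<open>I\<close> a combination of rows with
  coefficients given by \<open>u\<close>.\<close>

definition shear :: "nat set \<Rightarrow> (nat \<Rightarrow> nat \<Rightarrow>\<^sub>0 'a::field) \<Rightarrow> 'a imat" where
  "shear I u i l = imat_one i l + (if i \<in> I then Poly_Mapping.lookup (u i) l else 0)"

definition imat_transpose :: "'a imat \<Rightarrow> 'a imat" where
  "imat_transpose A i j = A j i"

lemma imat_mult_transpose:
  fixes A B :: "'a::comm_semiring_0 imat"
  shows "imat_mult (imat_transpose A) (imat_transpose B) = imat_transpose (imat_mult B A)"
  by (simp add: imat_mult_def imat_transpose_def fun_eq_iff mult.commute)

lemma imat_transpose_GL:
  assumes "A \<in> carrier GL_inf"
  shows "imat_transpose A \<in> carrier (GL_inf :: 'a::field imat monoid)"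
proof -
  obtain B where B: "finite {(i, j). B i j \<noteq> imat_one i j}" "imat_mult A B = imat_one" "imat_mult B A = imat_one"
    and A: "finite {(i, j). A i j \<noteq> imat_one i j}"
    using assms unfolding carrier_GL_inf by blast
  have one: "imat_transpose imat_one = (imat_one :: 'a imat)"
    by (auto simp: imat_transpose_def imat_one_def fun_eq_iff)
  have fin: "finite {(i, j). imat_transpose C i j \<noteq> imat_one i j}"
    if "finite {(i, j). C i j \<noteq> imat_one i j}" for C :: "'a imat"
  proof -
    have "{(i, j). imat_transpose C i j \<noteq> imat_one i j} = prod.swap ` {(i, j). C i j \<noteq> imat_one i j}"
      by (force simp: imat_transpose_def imat_one_def image_iff)
    then show ?thesis using that by simp
  qed
  show ?thesis
    unfolding carrier_GL_inf
    by (intro CollectI conjI exI[of _ "imat_transpose B"] fin A B(1)) (simp_all add: imat_mult_transpose B one)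
qed

lemma shear_mult:
  "imat_mult (shear I u) M i j = M i j + (if i \<in> I then pair (u i) (\<lambda>l. M l j) else 0)"
proof (cases "i \<in> I")
  case False
  then show ?thesis
    by (subst imat_mult_superset[of "{i}"]) (auto simp: shear_def imat_one_def)
next
  case True
  let ?L = "insert i (Poly_Mapping.keys (u i))"
  have "imat_mult (shear I u) M i j = (\<Sum>l\<in>?L. shear I u i l * M l j)"
    by (rule imat_mult_superset) (auto simp: shear_def imat_one_def in_keys_iff)
  also have "\<dots> = (\<Sum>l\<in>?L. (if l = i then M l j else 0)) + (\<Sum>l\<in>?L. Poly_Mapping.lookup (u i) l * M l j)"
    unfolding sum.distrib[symmetric]
    by (intro sum.cong) (auto simp: shear_def imat_one_def True distrib_right)
  also have "(\<Sum>l\<in>?L. Poly_Mapping.lookup (u i) l * M l j) = pair (u i) (\<lambda>l. M l j)"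
    by (rule pair_superset[symmetric]) auto
  finally show ?thesis using True by (simp add: sum.delta)
qed

lemma shear_mult_right:
  "imat_mult M (imat_transpose (shear J w)) i j = M i j + (if j \<in> J then pair (w j) (M i) else 0)"
proof -
  have "imat_mult M (imat_transpose (shear J w)) i j = imat_mult (shear J w) (imat_transpose M) j i"
    by (simp add: imat_mult_def imat_transpose_def mult.commute)
  then show ?thesis by (simp add: shear_mult imat_transpose_def)
qed

lemma pair_imat_one: "pair u (imat_one l) = Poly_Mapping.lookup u l"
  by (subst pair_superset[of "insert l (Poly_Mapping.keys u)"])
     (auto simp: imat_one_def in_keys_iff if_distrib cong: if_cong)

lemma imat_one_commute: "imat_one i j = imat_one j i"
  by (simp add: imat_one_def)

text \<open>The rows in the supports lie outside \<open>I\<close>, where a shear agrees with the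
  identity. Hence the shear by \<open>- u\<close> undoes the one by \<open>u\<close>.\<close>

lemma shear_GL:
  assumes "finite I" "\<And>i. i \<in> I \<Longrightarrow> Poly_Mapping.keys (u i) \<inter> I = {}"
  shows "shear I u \<in> carrier GL_inf"
proof -
  have fin: "finite {(i, j). shear I v i j \<noteq> imat_one i j}" for v :: "nat \<Rightarrow> nat \<Rightarrow>\<^sub>0 'a"
    by (rule finite_subset[of _ "SIGMA i:I. Poly_Mapping.keys (v i)"])
       (use assms(1) in \<open>auto simp: shear_def in_keys_iff split: if_splits\<close>)
  have inv: "imat_mult (shear I v) (shear I v') = imat_one"
    if "\<And>i. i \<in> I \<Longrightarrow> Poly_Mapping.keys (v i) \<inter> I = {}" "\<And>i. v' i = - v i"
    for v v' :: "nat \<Rightarrow> nat \<Rightarrow>\<^sub>0 'a"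
  proof (intro ext)
    fix i j
    have "pair (v i) (\<lambda>l. shear I v' l j) = Poly_Mapping.lookup (v i) j" if "i \<in> I"
    proof -
      have "pair (v i) (\<lambda>l. shear I v' l j) = pair (v i) (imat_one j)"
        unfolding pair_def using that(1) \<open>\<And>i. i \<in> I \<Longrightarrow> Poly_Mapping.keys (v i) \<inter> I = {}\<close>[of i]
        by (intro sum.cong) (auto simp: shear_def imat_one_commute)
      then show ?thesis by (simp add: pair_imat_one)
    qed
    then show "imat_mult (shear I v) (shear I v') i j = imat_one i j"
      by (simp add: shear_mult) (simp add: shear_def that(2) lookup_uminus)
  qed
  have "Poly_Mapping.keys (- u i) = Poly_Mapping.keys (u i)" for i by (auto simp: in_keys_iff)
  then show ?thesis
    unfolding carrier_GL_inf
    using assms(2) by (intro CollectI conjI exI[of _ "shear I (\<lambda>i. - u i)"] fin inv) auto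
qed

section \<open>Prescribing matrix entries in a finite window\<close>

lemma pair_swap:
  "pair u (\<lambda>l. pair w (M l)) = pair w (\<lambda>j. pair u (\<lambda>l. M l j))"
  unfolding pair_def by (simp add: sum_distrib_left mult_ac) (rule sum.swap)

text \<open>Finitely many columns of \<open>P\<close> and rows of \<open>Q\<close> do not matter, so these indices are not bounded.\<close>

fun coord_bound :: "coord \<Rightarrow> nat" where
  "coord_bound (Mat_coord k i j) = max i j"
| "coord_bound (Left_coord i j) = i"
| "coord_bound (Right_coord i j) = j"
| "coord_bound (Vec_coord k) = 0"

text \<open>Only finitely many variables occur in \<open>f\<close>, and \<open>s\<close> exceeds
  their bounds. To keep a value of \<open>f\<close>, it is enough to match points in this
  window.\<close>

lemma value_at_window:
  "\<exists>s. \<forall>x y. (\<forall>c. coord_bound c < s \<longrightarrow> coord_of x c = coord_of y c) \<longrightarrow>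
     value_at f x = value_at f (y :: 'a::field point)"
proof -
  let ?C = "\<Union>\<mu>\<in>Poly_Mapping.keys f. Poly_Mapping.keys \<mu>"
  obtain s where s: "\<And>c. c \<in> ?C \<Longrightarrow> coord_bound c < s"
    using finite_nat_set_iff_bounded[of "coord_bound ` ?C"] by auto
  have "value_at f x = value_at f y"
    if "\<forall>c. coord_bound c < s \<longrightarrow> coord_of x c = coord_of y c" for x y :: "'a point"
    unfolding value_at_def peval_def
  proof (intro sum.cong refl arg_cong2[of _ _ _ _ "(*)"] prod.cong)
    fix \<mu> c assume "\<mu> \<in> Poly_Mapping.keys f" "c \<in> Poly_Mapping.keys \<mu>"
    then have "coord_of x c = coord_of y c" using s[of c] that by blast
    then show "coord_of x c ^ Poly_Mapping.lookup \<mu> c = coord_of y c ^ Poly_Mapping.lookup \<mu> c" by simp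
  qed
  then show ?thesis by blast
qed

text \<open>The \<open>u i\<close> are chosen one row after another. If a row admits no choice, the
  \<open>M k\<close> are locally dependent on the annihilator of \<open>Z\<close>, which forces a
  combination of small rank.\<close>

lemma independent_rows_exist:
  fixes M :: "nat \<Rightarrow> 'a::field imat"
  assumes inf: "infinite (UNIV :: 'a set)" and Z: "finite Z" and D0: "finite D0"
    and norank: "\<And>c. \<exists>l<p. c l \<noteq> 0 \<Longrightarrow>
      \<not> rank_le (\<lambda>i j. \<Sum>k<p. c k * M k i j) (card D0 + r * p + p + p + card Z)"
  shows "\<exists>u. (\<forall>i<r. u i \<in> annihilator Z) \<and>
    indep_mod ({..<r} \<times> {..<p}) (\<lambda>(i, k). M k i + rowcomb (u i) (M k)) (seqs.span D0)"
proof -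
  \<comment> \<open>The bound on \<open>card D\<close> holds at every stage. Local dependence adds
    \<open>p\<close>, and passing from the annihilator to all \<open>u\<close> adds
    \<open>card Z\<close>.\<close>
  have step: "\<exists>u\<in>annihilator Z. indep_mod {..<p} (\<lambda>k. rowcomb u (M k)) (seqs.span D)"
    if D: "finite D" "card D \<le> card D0 + r * p + p" for D
  proof (rule ccontr)
    assume "\<not> ?thesis"
    then obtain c D1 where c: "\<exists>l<p. c l \<noteq> 0" and D1: "finite D1" "card D1 \<le> card D + p"
      "\<And>u. u \<in> annihilator Z \<Longrightarrow> rowcomb u (\<lambda>i j. \<Sum>k<p. c k * M k i j) \<in> seqs.span D1"
      using locally_dependent_lincomb[OF inf D(1), of Z p M] by blast
    from rowcomb_span_extend[OF Z D1(1,3)] obtain D2 where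
      D2: "finite D2" "card D2 \<le> card D1 + card Z"
      "\<forall>u. rowcomb u (\<lambda>i j. \<Sum>k<p. c k * M k i j) \<in> seqs.span D2" by blast
    have "(\<lambda>j. \<Sum>k<p. c k * M k i j) \<in> seqs.span D2" for i
      using D2(3)[rule_format, of "Poly_Mapping.single i 1"] by simp
    then have "rank_le (\<lambda>i j. \<Sum>k<p. c k * M k i j) (card D0 + r * p + p + p + card Z)"
      using D D1 D2 by (intro rank_le_rows_in_span[of D2]) auto
    then show False using norank[OF c] by blast
  qed
  have "q \<le> r \<Longrightarrow> \<exists>u. (\<forall>i<q. u i \<in> annihilator Z) \<and>
    indep_mod ({..<q} \<times> {..<p}) (\<lambda>(i, k). M k i + rowcomb (u i) (M k)) (seqs.span D0)" for q
  proof (induction q)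
    case 0
    then show ?case by (simp add: indep_mod_def)
  next
    case (Suc q)
    then have "q \<le> r" by simp
    from Suc.IH[OF this] obtain u where u: "\<forall>i<q. u i \<in> annihilator Z"
      "indep_mod ({..<q} \<times> {..<p}) (\<lambda>(i, k). M k i + rowcomb (u i) (M k)) (seqs.span D0)"
      by blast
    let ?F = "(\<lambda>(i, k). M k i + rowcomb (u i) (M k)) ` ({..<q} \<times> {..<p})"
    let ?G = "(\<lambda>k. M k q) ` {..<p}"
    \<comment> \<open>The unmodified rows \<open>M k q\<close> are included, so that adding them to
      the new rows does not destroy independence.\<close>
    let ?D = "D0 \<union> ?F \<union> ?G"
    have "card ?D \<le> card D0 + card ?F + card ?G"
      using card_Un_le[of "D0 \<union> ?F" ?G] card_Un_le[of D0 ?F] by linarith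
    moreover have "card ?F \<le> q * p" "card ?G \<le> p"
      using card_image_le[of "{..<q} \<times> {..<p}" "\<lambda>(i, k). M k i + rowcomb (u i) (M k)"]
        card_image_le[of "{..<p}" "\<lambda>k. M k q"] by auto
    moreover have "q * p \<le> r * p" using Suc.prems by simp
    ultimately have "card ?D \<le> card D0 + r * p + p" by linarith
    then obtain v where v: "v \<in> annihilator Z"
      "indep_mod {..<p} (\<lambda>k. rowcomb v (M k)) (seqs.span ?D)"
      using step[of ?D] D0 by auto
    define u' where "u' = u(q := v)"
    have "\<forall>j\<in>{..<Suc q} \<times> {..<p}. c j = 0"
      if c: "(\<Sum>j\<in>{..<Suc q} \<times> {..<p}. sscale (c j) (case j of (i, k) \<Rightarrow> M k i + rowcomb (u' i) (M k)))
        \<in> seqs.span D0" for c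
    proof -
      let ?f = "\<lambda>j. sscale (c j) (case j of (i, k) \<Rightarrow> M k i + rowcomb (u' i) (M k))"
      let ?X = "\<Sum>j\<in>{..<q} \<times> {..<p}. sscale (c j) (case j of (i, k) \<Rightarrow> M k i + rowcomb (u i) (M k))"
      let ?Y1 = "\<Sum>k<p. sscale (c (q, k)) (M k q)"
      let ?Y2 = "\<Sum>k<p. sscale (c (q, k)) (rowcomb v (M k))"
      have "sum ?f ({..<Suc q} \<times> {..<p}) = sum ?f ({..<q} \<times> {..<p} \<union> {q} \<times> {..<p})"
        by (intro sum.cong) auto
      also have "\<dots> = sum ?f ({..<q} \<times> {..<p}) + sum ?f ({q} \<times> {..<p})"
        by (intro sum.union_disjoint) auto
      also have "sum ?f ({..<q} \<times> {..<p}) = ?X"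
        by (intro sum.cong) (auto simp: u'_def)
      also have "sum ?f ({q} \<times> {..<p}) = (\<Sum>k<p. ?f (q, k))"
        unfolding sum.cartesian_product' by simp
      also have "\<dots> = ?Y1 + ?Y2"
        by (simp add: u'_def seqs.scale_right_distrib sum.distrib)
      finally have sum: "sum ?f ({..<Suc q} \<times> {..<p}) = ?X + (?Y1 + ?Y2)" .
      have "?X \<in> seqs.span ?D" "?Y1 \<in> seqs.span ?D"
        by (intro seqs.span_sum seqs.span_scale seqs.span_base; blast)+
      moreover have "sum ?f ({..<Suc q} \<times> {..<p}) \<in> seqs.span ?D"
        using c seqs.span_mono[of D0 ?D] by blast
      moreover have "?Y2 = sum ?f ({..<Suc q} \<times> {..<p}) - ?X - ?Y1" unfolding sum by simp
      ultimately have "?Y2 \<in> seqs.span ?D" by (simp only: seqs.span_diff)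
      then have cq: "\<forall>k\<in>{..<p}. c (q, k) = 0"
        using v(2)[unfolded indep_mod_def, THEN spec[of _ "\<lambda>k. c (q, k)"]] by blast
      then have "?Y1 = 0" "?Y2 = 0" by simp_all
      then have "?X \<in> seqs.span D0" using c unfolding sum by simp
      then have "\<forall>j\<in>{..<q} \<times> {..<p}. c j = 0" using u(2) unfolding indep_mod_def by blast
      then show ?thesis using cq by (auto simp: less_Suc_eq)
    qed
    then have "indep_mod ({..<Suc q} \<times> {..<p}) (\<lambda>(i, k). M k i + rowcomb (u' i) (M k)) (seqs.span D0)"
      unfolding indep_mod_def by blast
    moreover have "\<forall>i<Suc q. u' i \<in> annihilator Z" using u v by (auto simp: u'_def less_Suc_eq)
    ultimately show ?case by blast
  qed
  then show ?thesis by blast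
qed

text \<open>Row operations make the first \<open>s\<close> rows of all \<open>M k\<close>
  independent without changing \<open>P\<close> there. Functionals dual to these rows then give
  column operations that reach any prescribed values without changing \<open>Q\<close>
  there.\<close>

lemma window_prescribed:
  fixes M :: "nat \<Rightarrow> 'a::field imat"
  assumes inf: "infinite (UNIV :: 'a set)"
    and norank: "\<And>c. \<exists>l<p. c l \<noteq> 0 \<Longrightarrow>
      \<not> rank_le (\<lambda>i j. \<Sum>k<p. c k * M k i j) ((m + s) + s * p + p + p + (n + s))"
  shows "\<exists>a\<in>carrier GL_inf. \<exists>b\<in>carrier GL_inf.
    (\<forall>k<p. \<forall>i<s. \<forall>j<s. imat_mult a (imat_mult (M k) b) i j = M' k i j) \<and>
    (\<forall>i<s. \<forall>j<n. imat_mult a P i j = P i j) \<and> (\<forall>i<m. \<forall>j<s. imat_mult Q b i j = Q i j)"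
proof -
  \<comment> \<open>Vanishing on the columns of \<open>P\<close> and the rows of \<open>Q\<close>
    keeps these fixed. Vanishing on the unit vectors \<open>imat_one l\<close> keeps the supports
    out of the window, as \<open>shear_GL\<close> requires.\<close>
  define Z where "Z = (\<lambda>j i. P i j) ` {..<n} \<union> imat_one ` {..<s}"
  define D where "D = Q ` {..<m} \<union> imat_one ` {..<s}"
  have fin: "finite Z" "finite D" by (simp_all add: Z_def D_def)
  have cards: "card Z \<le> n + s" "card D \<le> m + s"
    unfolding Z_def D_def
    by (rule order_trans[OF card_Un_le add_mono]; rule order_trans[OF card_image_le]; simp)+
  have "\<not> rank_le (\<lambda>i j. \<Sum>k<p. c k * M k i j) (card D + s * p + p + p + card Z)"
    if "\<exists>l<p. c l \<noteq> 0" for c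
    using norank[OF that] rank_le_mono[of _ "card D + s * p + p + p + card Z"] cards by fastforce
  from independent_rows_exist[OF inf fin this] obtain u where
    u: "\<And>i. i < s \<Longrightarrow> u i \<in> annihilator Z"
    "indep_mod ({..<s} \<times> {..<p}) (\<lambda>(i, k). M k i + rowcomb (u i) (M k)) (seqs.span D)" by blast
  let ?J = "{..<s} \<times> {..<p}"
  have "finite ?J" by simp
  from dual_family[OF this fin(2) u(2)] obtain w where
    dual: "\<forall>j\<in>?J. (\<forall>d\<in>D. pair (w j) d = 0) \<and> (\<forall>j'\<in>?J.
      pair (w j) (case j' of (i, k) \<Rightarrow> M k i + rowcomb (u i) (M k)) = (if j' = j then 1 else 0))"
    by blast
  have w: "pair (w j) d = 0" if "j \<in> ?J" "d \<in> D" for j d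
    using dual that by blast
  have w': "pair (w j) (M k i + rowcomb (u i) (M k)) = (if (i, k) = j then 1 else 0)"
    if "j \<in> ?J" "i < s" "k < p" for i j k
    using dual[rule_format, OF that(1), THEN conjunct2, THEN bspec, of "(i, k)"] that(2,3) by simp
  \<comment> \<open>\<open>t\<close> is the defect left by the row operations, and
    \<open>x j\<close> is a functional with exactly these values on the modified rows.\<close>
  define t where "t = (\<lambda>j (i, k). M' k i j - (M k i j + rowcomb (u i) (M k) j))"
  define x where "x j = (\<Sum>e\<in>?J. pscale (t j e) (w e))" for j
  have x_D: "pair (x j) d = 0" if "d \<in> D" for j d
    using w[OF _ that] by (simp add: x_def pair_sum_left pair_pscale_left)
  have x_M: "pair (x j) (M k i + rowcomb (u i) (M k)) = t j (i, k)" if "i < s" "k < p" for i k j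
  proof -
    have "pair (x j) (M k i + rowcomb (u i) (M k)) = (\<Sum>e\<in>?J. t j e * (if (i, k) = e then 1 else 0))"
      unfolding x_def pair_sum_left pair_pscale_left
      using w'[OF _ that] by (intro sum.cong refl arg_cong2[of _ _ _ _ "(*)"])
    also have "\<dots> = t j (i, k)" using that by (simp add: if_distrib cong: if_cong)
    finally show ?thesis .
  qed
  have keys_u: "Poly_Mapping.keys (u i) \<inter> {..<s} = {}" if "i < s" for i
  proof -
    have "pair (u i) (imat_one l) = 0" if "l < s" for l
      using u(1)[OF \<open>i < s\<close>] that unfolding annihilator_def Z_def by blast
    then show ?thesis by (auto simp: in_keys_iff pair_imat_one)
  qed
  have "imat_one l \<in> D" if "l < s" for l using that by (auto simp: D_def)
  then have "pair (x j) (imat_one l) = 0" if "l < s" for j l using x_D that by blast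
  then have keys_x: "Poly_Mapping.keys (x j) \<inter> {..<s} = {}" for j
    by (auto simp: in_keys_iff pair_imat_one)
  show ?thesis
  proof (rule bexI[of _ "shear {..<s} u"], rule bexI[of _ "imat_transpose (shear {..<s} x)"], intro conjI allI impI)
    show "shear {..<s} u \<in> carrier GL_inf" "imat_transpose (shear {..<s} x) \<in> carrier GL_inf"
      using keys_u keys_x by (auto intro!: shear_GL imat_transpose_GL)
    fix i j assume "i < s" "j < n"
    then have "pair (u i) (\<lambda>l. P l j) = 0" using u(1)[of i] by (auto simp: annihilator_def Z_def)
    then show "imat_mult (shear {..<s} u) P i j = P i j" by (simp add: shear_mult)
  next
    fix i j assume "i < m" "j < s"
    then have "pair (x j) (Q i) = 0" using x_D[of "Q i"] by (auto simp: D_def)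
    then show "imat_mult Q (imat_transpose (shear {..<s} x)) i j = Q i j" by (simp add: shear_mult_right)
  next
    fix k i j assume kij: "k < p" "i < s" "j < s"
    have split: "pair v (\<lambda>l. f l + g l) = pair v f + pair v g" for v and f g :: "nat \<Rightarrow> 'a"
      using pair_add_right[of v f g] by (simp add: plus_fun_def)
    have "imat_mult (shear {..<s} u) (imat_mult (M k) (imat_transpose (shear {..<s} x))) i j =
      M k i j + pair (x j) (M k i) + pair (u i) (\<lambda>l. M k l j + pair (x j) (M k l))"
      using kij by (simp add: shear_mult shear_mult_right)
    also have "\<dots> = M k i j + rowcomb (u i) (M k) j + (pair (x j) (M k i) + pair (x j) (rowcomb (u i) (M k)))"
      unfolding split pair_swap[of "u i"] rowcomb_def by simp
    also have "\<dots> = M' k i j"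
      unfolding pair_add_right[symmetric] x_M[OF kij(2,1)] by (simp add: t_def)
    finally show "imat_mult (shear {..<s} u) (imat_mult (M k) (imat_transpose (shear {..<s} x))) i j = M' k i j" .
  qed
qed

text \<open>By \<open>window_prescribed\<close>, if no combination had small rank, the orbit would
  contain a point that agrees with \<open>(M', P, Q, v)\<close> in the window of \<open>f\<close>.
  \<open>K\<close> depends only on this window and the shape.\<close>

lemma bounded_rank_of_vanishing:
  fixes f :: "(coord, 'a::field) mpol"
  assumes inf: "infinite (UNIV :: 'a set)"
  shows "\<exists>K. \<forall>M M' P Q v. (M, P, Q, v) \<in> A_space p n m d \<longrightarrow> (M', P, Q, v) \<in> A_space p n m d \<longrightarrow>
    value_at f (M', P, Q, v) \<noteq> 0 \<longrightarrow>
    (\<forall>a\<in>carrier GL_inf. \<forall>b\<in>carrier GL_inf. value_at f (transform a b (M, P, Q, v)) = 0) \<longrightarrow>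
    (\<exists>c. (\<exists>l<p. c l \<noteq> 0) \<and> rank_le (\<lambda>i j. \<Sum>k<p. c k * M k i j) K)"
proof -
  obtain s where s: "\<And>x y. (\<And>c. coord_bound c < s \<Longrightarrow> coord_of x c = coord_of y c) \<Longrightarrow>
      value_at f x = value_at f y"
    using value_at_window[of f] by metis
  let ?K = "(m + s) + s * p + p + p + (n + s)"
  show ?thesis
  proof (intro exI[of _ ?K] allI impI, rule ccontr)
    fix M M' P Q v
    assume x: "(M, P, Q, v) \<in> A_space p n m d" "(M', P, Q, v) \<in> A_space p n m d"
      and nz: "value_at f (M', P, Q, v) \<noteq> 0"
      and vanish: "\<forall>a\<in>carrier GL_inf. \<forall>b\<in>carrier GL_inf. value_at f (transform a b (M, P, Q, v)) = 0"
      and "\<nexists>c. (\<exists>l<p. c l \<noteq> 0) \<and> rank_le (\<lambda>i j. \<Sum>k<p. c k * M k i j) ?K"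
    then have norank: "\<not> rank_le (\<lambda>i j. \<Sum>k<p. c k * M k i j) ?K" if "\<exists>l<p. c l \<noteq> 0" for c
      using that by blast
    have "\<exists>a\<in>carrier GL_inf. \<exists>b\<in>carrier GL_inf.
      (\<forall>k<p. \<forall>i<s. \<forall>j<s. imat_mult a (imat_mult (M k) b) i j = M' k i j) \<and>
      (\<forall>i<s. \<forall>j<n. imat_mult a P i j = P i j) \<and> (\<forall>i<m. \<forall>j<s. imat_mult Q b i j = Q i j)"
      by (rule window_prescribed[OF inf norank])
    then obtain a b where
      ab: "a \<in> carrier GL_inf" "b \<in> carrier GL_inf"
      "\<forall>k<p. \<forall>i<s. \<forall>j<s. imat_mult a (imat_mult (M k) b) i j = M' k i j"
      "\<forall>i<s. \<forall>j<n. imat_mult a P i j = P i j" "\<forall>i<m. \<forall>j<s. imat_mult Q b i j = Q i j"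
      by (elim bexE conjE)
    have t: "transform a b (M, P, Q, v) \<in> A_space p n m d" using x(1) by (rule transform_A_space)
    have "value_at f (transform a b (M, P, Q, v)) = value_at f (M', P, Q, v)"
    proof (rule s)
      fix c assume "coord_bound c < s"
      \<comment> \<open>Inside the shape the agreement comes from \<open>ab\<close>; outside it,
        both points have zero coordinates.\<close>
      then show "coord_of (transform a b (M, P, Q, v)) c = coord_of (M', P, Q, v) c"
      proof (cases c)
        case (Mat_coord k i j)
        then show ?thesis using \<open>coord_bound c < s\<close> ab(3) t x
          by (cases "k < p") (auto simp: transform_def A_space_def)
      next
        case (Left_coord i j)
        then show ?thesis using \<open>coord_bound c < s\<close> ab(4) t x
          by (cases "j < n") (auto simp: transform_def A_space_def)
      next
        case (Right_coord i j)
        then show ?thesis using \<open>coord_bound c < s\<close> ab(5) t x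
          by (cases "i < m") (auto simp: transform_def A_space_def)
      qed (simp add: transform_def)
    qed
    then show False using nz vanish ab by metis
  qed
qed


section \<open>The induction on the number of matrices\<close>

text \<open>Noetherianity for sequences of points and polynomials; the first argument carries the
  field.\<close>

definition good_pairs :: "'a::field itself \<Rightarrow> nat \<Rightarrow> nat \<Rightarrow> nat \<Rightarrow> nat \<Rightarrow> bool" where
  "good_pairs _ p n m d \<longleftrightarrow>
     (\<forall>(x :: nat \<Rightarrow> 'a point) f. (\<forall>i. x i \<in> A_space p n m d \<and> value_at (f i) (x i) \<noteq> 0) \<longrightarrow>
       (\<exists>i j. i < j \<and> (\<exists>a\<in>carrier GL_inf. \<exists>b\<in>carrier GL_inf. value_at (f i) (transform a b (x j)) \<noteq> 0)))"

text \<open>Pulls \<open>f\<close> back along a polynomial map with coordinate functions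
  \<open>\<sigma> c\<close>.\<close>

lemma value_at_substitution:
  assumes "\<And>c. value_at (\<sigma> c) y = coord_of x c"
  shows "value_at (peval Const \<sigma> f) y = value_at f x"
  unfolding value_at_subst assms by (simp add: value_at_def)

lemma is_subring_peval:
  assumes "is_subring R" "range Const \<subseteq> R" "\<And>c. \<sigma> c \<in> R"
  shows "peval Const \<sigma> f \<in> R"
  unfolding peval_def
  by (intro is_subring_sum is_subring_closed(4) is_subring_prod is_subring_power assms
      subsetD[OF assms(2)] rangeI)

lemma GL_inf_mult_closed:
  "a \<in> carrier GL_inf \<Longrightarrow> b \<in> carrier GL_inf \<Longrightarrow> imat_mult a b \<in> carrier (GL_inf :: 'a::field imat monoid)"
  using group_GL_inf[where 'a = 'a] by (metis group.is_monoid monoid.m_closed mult_GL_inf)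

lemma transform_transform_GL:
  assumes "a \<in> carrier GL_inf" "a' \<in> carrier GL_inf" "b \<in> carrier GL_inf" "b' \<in> carrier GL_inf"
  shows "transform a b (transform a' b' x) = transform (imat_mult a a') (imat_mult b' b) x"
  by (intro transform_transform GL_inf_fin assms)

section \<open>The base case without matrices\<close>

text \<open>Gaussian elimination on the last column, one pivot row per column. The selection
  \<open>R\<close> need not be injective.\<close>

lemma rows_generated_by_selection:
  fixes P :: "'a::field imat"
  assumes "\<And>i j. j \<ge> n \<Longrightarrow> P i j = 0"
  shows "\<exists>G R. \<forall>i j. P i j = (\<Sum>s<n. G i s * P (R s) j)"
  using assms
proof (induction n arbitrary: P)
  case (Suc n)
  show ?case
  proof (cases "\<exists>r. P r n \<noteq> 0")
    case False
    then have "P i j = 0" if "j \<ge> n" for i j using Suc.prems[of j i] that by (cases "j = n") auto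
    from Suc.IH[of P, OF this] obtain G R where GR: "\<forall>i j. P i j = (\<Sum>s<n. G i s * P (R s) j)"
      by auto
    have "P i j = (\<Sum>s<Suc n. (if s = n then 0 else G i s) * P (R s) j)" for i j
      by (subst GR[rule_format]) (auto intro!: sum.cong)
    then show ?thesis by (intro exI[of _ "\<lambda>i s. if s = n then 0 else G i s"] exI[of _ R]) blast
  next
    case True
    then obtain r where r: "P r n \<noteq> 0" by blast
    \<comment> \<open>Clears column \<open>n\<close> with the pivot row \<open>r\<close>, leaving
      one column less.\<close>
    define P' where "P' i j = P i j - P i n / P r n * P r j" for i j
    have "P' i j = 0" if "j \<ge> n" for i j using Suc.prems that r by (cases "j = n") (auto simp: P'_def)
    from Suc.IH[of P', OF this] obtain G R where GR: "\<forall>i j. P' i j = (\<Sum>s<n. G i s * P' (R s) j)"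
      by auto
    \<comment> \<open>Expressing the rows of \<open>P'\<close> by those of \<open>P\<close> produces
      multiples of the pivot row, which are collected at position \<open>n\<close>.\<close>
    define G' where "G' i s = (if s = n then P i n / P r n - (\<Sum>s<n. G i s * (P (R s) n / P r n)) else G i s)" for i s
    define R' where "R' s = (if s = n then r else R s)" for s
    have "P i j = (\<Sum>s<Suc n. G' i s * P (R' s) j)" for i j
    proof -
      have "P i j = P i n / P r n * P r j + P' i j" by (simp add: P'_def)
      also have "P' i j = (\<Sum>s<n. G i s * P' (R s) j)" using GR by blast
      also have "\<dots> = (\<Sum>s<n. G i s * P (R s) j) - (\<Sum>s<n. G i s * (P (R s) n / P r n)) * P r j"
        by (simp add: P'_def right_diff_distrib sum_subtractf sum_distrib_right mult.assoc)
      also have "(\<Sum>s<n. G i s * P (R s) j) = (\<Sum>s<n. G' i s * P (R' s) j)"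
        by (intro sum.cong) (auto simp: G'_def R'_def)
      finally show ?thesis by (simp add: G'_def R'_def algebra_simps)
    qed
    then show ?thesis by blast
  qed
qed simp

text \<open>
  Copying the rows \<open>R t\<close> to fresh rows first makes both steps shears, even if some \<open>R t\<close> lie in the
  window.
\<close>

lemma row_operations_prescribed:
  fixes P :: "'a::field imat" and n :: nat
  assumes GR: "\<And>i j. P i j = (\<Sum>t<n. G i t * P (R t) j)"
  shows "\<exists>a\<in>carrier GL_inf. \<forall>i<s. \<forall>j. imat_mult a P i j = (\<Sum>t<n. H i t * P (R t) j)"
proof -
  have "finite (R ` {..<n})" by simp
  then obtain N0 where N0: "\<And>t. t < n \<Longrightarrow> R t < N0"
    unfolding finite_nat_set_iff_bounded by blast
  \<comment> \<open>The fresh rows from \<open>N\<close> on lie beyond the window and beyond all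
    selected rows.\<close>
  define N where "N = N0 + s"
  have N: "R t < N" if "t < n" for t using N0[OF that] by (simp add: N_def)
  \<comment> \<open>The subtracted sum is the expansion of row \<open>l\<close> itself, so the fresh
    row \<open>l\<close> is replaced by row \<open>R (l - N)\<close>.\<close>
  define u1 where "u1 l = Poly_Mapping.single (R (l - N)) 1 -
    (\<Sum>t<n. Poly_Mapping.single (R t) (G l t))" for l
  \<comment> \<open>With the copies in place, the coefficients are changed from \<open>G\<close> to
    \<open>H\<close> by adding fresh rows only.\<close>
  define u2 where "u2 i = (\<Sum>t<n. Poly_Mapping.single (N + t) (H i t - G i t))" for i
  let ?a1 = "shear {N..<N + n} u1" and ?a2 = "shear {..<s} u2"
  have "Poly_Mapping.keys (u1 l) \<inter> {N..<N + n} = {}" if "l \<in> {N..<N + n}" for l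
  proof -
    have "Poly_Mapping.lookup (u1 l) k = 0" if "k \<ge> N" for k
    proof -
      have "l - N < n" using \<open>l \<in> _\<close> by auto
      moreover have ne: "R t \<noteq> k" if "t < n" for t using N[OF that] \<open>k \<ge> N\<close> by simp
      moreover have "(\<Sum>t<n. Poly_Mapping.lookup (Poly_Mapping.single (R t) (G l t)) k) = 0"
        using ne by (intro sum.neutral) (auto simp: lookup_single)
      ultimately show ?thesis by (simp add: u1_def lookup_minus lookup_sum lookup_single)
    qed
    then show ?thesis by (auto simp: in_keys_iff)
  qed
  then have a1: "?a1 \<in> carrier GL_inf" by (intro shear_GL) auto
  have "Poly_Mapping.lookup (u2 i) k = 0" if "k < s" for i k
    using that by (auto simp: u2_def lookup_sum lookup_single when_def N_def intro!: sum.neutral)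
  then have a2: "?a2 \<in> carrier GL_inf" by (intro shear_GL) (auto simp: in_keys_iff)
  have P1: "imat_mult ?a1 P (N + t) j = P (R t) j" if "t < n" for t j
    using that GR[of "N + t" j]
    by (simp add: shear_mult u1_def pair_diff_left pair_sum_left)
  have "imat_mult (imat_mult ?a2 ?a1) P i j = (\<Sum>t<n. H i t * P (R t) j)" if "i < s" for i j
  proof -
    have "imat_mult (imat_mult ?a2 ?a1) P i j = imat_mult ?a2 (imat_mult ?a1 P) i j"
      by (simp add: imat_mult_assoc1[OF GL_inf_fin(1)[OF a2] GL_inf_fin(1)[OF a1]])
    also have "\<dots> = imat_mult ?a1 P i j + (\<Sum>t<n. (H i t - G i t) * imat_mult ?a1 P (N + t) j)"
      using that by (simp add: shear_mult[of "{..<s}"] u2_def pair_sum_left)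
    also have "(\<Sum>t<n. (H i t - G i t) * imat_mult ?a1 P (N + t) j) = (\<Sum>t<n. (H i t - G i t) * P (R t) j)"
      by (intro sum.cong) (simp_all add: P1)
    also have "imat_mult ?a1 P i j = (\<Sum>t<n. G i t * P (R t) j)"
      unfolding GR[symmetric] using that by (simp add: shear_mult N_def)
    finally show ?thesis by (simp add: left_diff_distrib sum_subtractf)
  qed
  then show ?thesis using GL_inf_mult_closed[OF a2 a1] by blast
qed

lemma column_operations_prescribed:
  fixes Q :: "'a::field imat" and m :: nat
  assumes "\<And>i j. Q i j = (\<Sum>t<m. G j t * Q i (R t))"
  shows "\<exists>b\<in>carrier GL_inf. \<forall>i. \<forall>j<s. imat_mult Q b i j = (\<Sum>t<m. H j t * Q i (R t))"
proof -
  obtain a where a: "a \<in> carrier GL_inf"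
    "\<forall>i<s. \<forall>j. imat_mult a (imat_transpose Q) i j = (\<Sum>t<m. H i t * imat_transpose Q (R t) j)"
    using row_operations_prescribed[of "imat_transpose Q" G R m s H] assms
    unfolding imat_transpose_def by blast
  have "imat_mult Q (imat_transpose a) i j = imat_mult a (imat_transpose Q) j i" for i j
    by (simp add: imat_mult_def imat_transpose_def mult.commute)
  then show ?thesis
    using a by (intro bexI[of _ "imat_transpose a"] imat_transpose_GL) (auto simp: imat_transpose_def)
qed

text \<open>In any finite window, operations can exchange the coefficients that express
  \<open>P\<close> and \<open>Q\<close> by selected rows and columns for those of another point.
  With these coefficients fixed for each polynomial, only finitely many variables remain.\<close>

lemma good_pairs_0: "good_pairs TYPE('a::field) 0 n m d"
  unfolding good_pairs_def
proof (intro allI impI)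
  fix x :: "nat \<Rightarrow> 'a point" and f
  assume xf: "\<forall>i. x i \<in> A_space 0 n m d \<and> value_at (f i) (x i) \<noteq> 0"
  define P Q v where "P k = fst (snd (x k))" and "Q k = fst (snd (snd (x k)))"
    and "v k = snd (snd (snd (x k)))" for k
  have x: "x k = (\<lambda>_ _ _. 0, P k, Q k, v k)" for k
    using xf[rule_format, of k] by (cases "x k") (auto simp: A_space_def P_def Q_def v_def fun_eq_iff)
  have zero: "j \<ge> n \<Longrightarrow> P k i j = 0" "i \<ge> m \<Longrightarrow> Q k i j = 0" "q \<ge> d \<Longrightarrow> v k q = 0" for i j k q
    using xf[rule_format, of k] unfolding x by (auto simp: A_space_def)
  have "\<exists>G R. \<forall>i j. P k i j = (\<Sum>t<n. G i t * P k (R t) j)" for k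
    using zero by (intro rows_generated_by_selection) auto
  then obtain G R where GR: "\<And>k i j. P k i j = (\<Sum>t<n. G k i t * P k (R k t) j)" by metis
  have "\<exists>G R. \<forall>j i. imat_transpose (Q k) j i = (\<Sum>t<m. G j t * imat_transpose (Q k) (R t) i)" for k
    using zero by (intro rows_generated_by_selection) (auto simp: imat_transpose_def)
  then have "\<exists>G R. \<forall>i j. Q k i j = (\<Sum>t<m. G j t * Q k i (R t))" for k
    unfolding imat_transpose_def by metis
  then obtain G' R' where GR': "\<And>k i j. Q k i j = (\<Sum>t<m. G' k j t * Q k i (R' k t))" by metis
  \<comment> \<open>\<open>y k\<close> holds the selected rows and columns of \<open>x k\<close>;
    \<open>z i k\<close> combines them with the coefficients of \<open>x i\<close>, so
    \<open>z k k = x k\<close>.\<close>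
  define y :: "nat \<Rightarrow> 'a point" where "y k = (\<lambda>_ _ _. 0, \<lambda>t. P k (R k t), \<lambda>i t. Q k i (R' k t), v k)" for k
  define z :: "nat \<Rightarrow> nat \<Rightarrow> 'a point" where "z i k = (\<lambda>_ _ _. 0, \<lambda>r j. \<Sum>t<n. G i r t * P k (R k t) j,
    \<lambda>r j. \<Sum>t<m. G' i j t * Q k r (R' k t), v k)" for i k
  \<comment> \<open>\<open>\<sigma> i\<close> expresses the coordinates of \<open>z i k\<close> by
    those of \<open>y k\<close>. Coordinates outside the shape become \<open>0\<close>, so that only
    the variables of \<open>V\<close> below occur.\<close>
  define \<sigma> :: "nat \<Rightarrow> coord \<Rightarrow> (coord, 'a) mpol" where "\<sigma> k c = (case c of
      Mat_coord _ _ _ \<Rightarrow> 0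
    | Left_coord i j \<Rightarrow> if j < n then \<Sum>t<n. Const (G k i t) * Var (Left_coord t j) else 0
    | Right_coord i j \<Rightarrow> if i < m then \<Sum>t<m. Const (G' k j t) * Var (Right_coord i t) else 0
    | Vec_coord q \<Rightarrow> if q < d then Var (Vec_coord q) else 0)" for k c
  define F where "F k = peval Const (\<sigma> k) (f k)" for k
  have F: "value_at (F i) (y k) = value_at (f i) (z i k)" for i k
    unfolding F_def
    by (rule value_at_substitution)
       (auto simp: \<sigma>_def y_def z_def zero value_at_sum split: coord.splits)
  define V where "V = case_prod Left_coord ` ({..<n} \<times> {..<n}) \<union>
    case_prod Right_coord ` ({..<m} \<times> {..<m}) \<union> Vec_coord ` {..<d}"
  have "finite V" by (simp add: V_def)
  from hilbert_basis_mpol[OF this] obtain S :: "(coord, 'a) mpol set" where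
    S: "is_subring S" "noetherian_on S" "range Const \<subseteq> S" "Var ` V \<subseteq> S" by blast
  have V: "Var (Left_coord t j) \<in> S" if "t < n" "j < n" for t j
    using that S(4) by (force simp: V_def)
  have V': "Var (Right_coord i t) \<in> S" if "t < m" "i < m" for t i
    using that S(4) by (force simp: V_def)
  have V'': "Var (Vec_coord q) \<in> S" if "q < d" for q
    using that S(4) by (force simp: V_def)
  have "\<sigma> k c \<in> S" for k c
    using S(3) V V' V''
    by (auto simp: \<sigma>_def is_subring_closed[OF S(1)] split: coord.splits
        intro!: is_subring_sum[OF S(1)] is_subring_closed(4)[OF S(1)])
  then have "range F \<subseteq> S" by (auto simp: F_def intro!: is_subring_peval[OF S(1,3)])
  then obtain k r where r: "F k = (\<Sum>i<k. r i * F i)"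
    using S(2) unfolding noetherian_on_def lincomb_def by blast
  have "z k k = x k" unfolding z_def x GR[symmetric] GR'[symmetric] by simp
  then have "value_at (F k) (y k) \<noteq> 0" using xf F by simp
  \<comment> \<open>Since \<open>F k\<close> is non-zero at \<open>y k\<close>, so is some earlier
    \<open>F i\<close> in its expansion.\<close>
  then have "(\<Sum>i<k. value_at (r i) (y k) * value_at (F i) (y k)) \<noteq> 0"
    by (subst (asm) r) (simp add: value_at_sum)
  then obtain i where "i \<in> {..<k}" "value_at (r i) (y k) * value_at (F i) (y k) \<noteq> 0"
    by (rule sum.not_neutral_contains_not_neutral)
  then have i: "i < k" "value_at (F i) (y k) \<noteq> 0" by auto
  obtain s where s: "\<And>x y. (\<And>c. coord_bound c < s \<Longrightarrow> coord_of x c = coord_of y c) \<Longrightarrow>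
      value_at (f i) x = value_at (f i) y"
    using value_at_window[of "f i"] by metis
  \<comment> \<open>In the window of \<open>f i\<close>, these operations carry \<open>x k\<close>
    to \<open>z i k\<close>.\<close>
  obtain a where a: "a \<in> carrier GL_inf"
    "\<And>r j. r < s \<Longrightarrow> imat_mult a (P k) r j = (\<Sum>t<n. G i r t * P k (R k t) j)"
    using row_operations_prescribed[of "P k", OF GR, of s "G i"] by blast
  obtain b where b: "b \<in> carrier GL_inf"
    "\<And>r j. j < s \<Longrightarrow> imat_mult (Q k) b r j = (\<Sum>t<m. G' i j t * Q k r (R' k t))"
    using column_operations_prescribed[of "Q k", OF GR', of s "G' i"] by blast
  have mult0: "imat_mult a' (imat_mult (\<lambda>_ _. 0) b') = (\<lambda>_ _. 0)" for a' b' :: "'a imat"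
    by (simp add: imat_mult_def fun_eq_iff)
  have "value_at (f i) (transform a b (x k)) = value_at (f i) (z i k)"
  proof (rule s)
    fix c assume "coord_bound c < s"
    then show "coord_of (transform a b (x k)) c = coord_of (z i k) c"
      by (cases c) (auto simp: transform_def x z_def a b mult0)
  qed
  then show "\<exists>i j. i < j \<and> (\<exists>a\<in>carrier GL_inf. \<exists>b\<in>carrier GL_inf. value_at (f i) (transform a b (x j)) \<noteq> 0)"
    using i a(1) b(1) F by metis
qed


text \<open>
  Matrix \<open>l\<close> is inserted: its coefficients with respect to the \<open>p\<close> given matrices are the last \<open>p\<close>
  vector coordinates, and its correction of rank at most \<open>K\<close> is the product of the last \<open>K\<close> columns
  of \<open>P\<close> and the last \<open>K\<close> rows of \<open>Q\<close>.
\<close>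

fun insert_matrix :: "nat \<Rightarrow> nat \<Rightarrow> nat \<Rightarrow> nat \<Rightarrow> nat \<Rightarrow> nat \<Rightarrow> 'a::field point \<Rightarrow> 'a point" where
  "insert_matrix p n m d l K (M, P, Q, v) =
     (\<lambda>q i j. if q = l then (\<Sum>r<p. v (d + r) * M r i j) + (\<Sum>s<K. P i (n + s) * Q (m + s) j)
        else M (if q < l then q else q - 1) i j,
      \<lambda>i j. if j < n then P i j else 0, \<lambda>i j. if i < m then Q i j else 0,
      \<lambda>q. if q < d then v q else 0)"

section \<open>Inserting a matrix: equivariance, surjectivity and pullback\<close>

lemma imat_mult3_expand:
  fixes a b :: "'a::field imat"
  assumes "row_fin a" "col_fin b"
  shows "imat_mult a (imat_mult X b) i j =
    (\<Sum>r | a i r \<noteq> 0. \<Sum>s | b s j \<noteq> 0. a i r * X r s * b s j)"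
proof -
  have "imat_mult a (imat_mult X b) i j = (\<Sum>r | a i r \<noteq> 0. a i r * imat_mult X b r j)"
    using assms(1) by (intro imat_mult_superset) (auto simp: row_fin_def)
  also have "\<dots> = (\<Sum>r | a i r \<noteq> 0. a i r * (\<Sum>s | b s j \<noteq> 0. X r s * b s j))"
    using assms(2) by (intro sum.cong refl arg_cong2[of _ _ _ _ "(*)"] imat_mult_superset) (auto simp: col_fin_def)
  finally show ?thesis by (simp add: sum_distrib_left mult.assoc)
qed

lemma imat_mult3_add:
  fixes a b :: "'a::field imat"
  assumes "row_fin a" "col_fin b"
  shows "imat_mult a (imat_mult (\<lambda>r s. X r s + Y r s) b) i j =
    imat_mult a (imat_mult X b) i j + imat_mult a (imat_mult Y b) i j"
  unfolding imat_mult3_expand[OF assms] by (simp add: distrib_left distrib_right sum.distrib)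

lemma imat_mult3_scale:
  fixes a b :: "'a::field imat"
  assumes "row_fin a" "col_fin b"
  shows "imat_mult a (imat_mult (\<lambda>r s. c * X r s) b) i j = c * imat_mult a (imat_mult X b) i j"
  unfolding imat_mult3_expand[OF assms] by (simp add: sum_distrib_left mult_ac)

lemma imat_mult3_sum:
  fixes a b :: "'a::field imat"
  assumes "row_fin a" "col_fin b" "finite I"
  shows "imat_mult a (imat_mult (\<lambda>r s. \<Sum>q\<in>I. X q r s) b) i j =
    (\<Sum>q\<in>I. imat_mult a (imat_mult (X q) b) i j)"
  using assms(3)
proof (induction I)
  case empty
  show ?case by (simp add: imat_mult_def)
next
  case (insert q I)
  have "imat_mult a (imat_mult (\<lambda>r s. \<Sum>q\<in>insert q I. X q r s) b) i j =
      imat_mult a (imat_mult (\<lambda>r s. X q r s + (\<Sum>q\<in>I. X q r s)) b) i j"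
    using insert.hyps by simp
  also have "\<dots> = (\<Sum>q\<in>insert q I. imat_mult a (imat_mult (X q) b) i j)"
    unfolding imat_mult3_add[OF assms(1,2)] using insert by simp
  finally show ?case .
qed

text \<open>Makes the correction term of \<open>insert_matrix\<close> equivariant: its column and
  row factors are acted on separately.\<close>

lemma imat_mult3_rank_one:
  fixes a b :: "'a::field imat"
  assumes "row_fin a" "col_fin b"
  shows "imat_mult a (imat_mult (\<lambda>r s. A r t * B t' s) b) i j = imat_mult a A i t * imat_mult B b t' j"
proof -
  have "imat_mult a A i t = (\<Sum>r | a i r \<noteq> 0. a i r * A r t)"
    using assms(1) by (intro imat_mult_superset) (auto simp: row_fin_def)
  moreover have "imat_mult B b t' j = (\<Sum>s | b s j \<noteq> 0. B t' s * b s j)"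
    using assms(2) by (intro imat_mult_superset) (auto simp: col_fin_def)
  ultimately show ?thesis
    unfolding imat_mult3_expand[OF assms] by (simp add: sum_product mult_ac)
qed

lemma insert_matrix_transform:
  fixes a b :: "'a::field imat"
  assumes ab: "row_fin a" "col_fin b"
  shows "insert_matrix p n m d l K (transform a b y) = transform a b (insert_matrix p n m d l K y)"
proof -
  obtain M P Q v where y: "y = (M, P, Q, v)" by (cases y)
  have 1: "imat_mult a (\<lambda>i j. if j < n then P i j else 0) = (\<lambda>i j. if j < n then imat_mult a P i j else 0)"
    by (auto simp: imat_mult_def fun_eq_iff)
  have 2: "imat_mult (\<lambda>i j. if i < m then Q i j else 0) b = (\<lambda>i j. if i < m then imat_mult Q b i j else 0)"
    by (auto simp: imat_mult_def fun_eq_iff)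
  have 3: "imat_mult a (imat_mult (\<lambda>i j. (\<Sum>r<p. v (d + r) * M r i j) + (\<Sum>s<K. P i (n + s) * Q (m + s) j)) b) i j =
     (\<Sum>r<p. v (d + r) * imat_mult a (imat_mult (M r) b) i j) +
     (\<Sum>s<K. imat_mult a P i (n + s) * imat_mult Q b (m + s) j)" for i j
    by (simp only: imat_mult3_add[OF ab] imat_mult3_sum[OF ab] finite_lessThan
        imat_mult3_scale[OF ab] imat_mult3_rank_one[OF ab])
  have "imat_mult a (imat_mult (\<lambda>i j. if q = l then X i j else Y i j) b) =
      (if q = l then imat_mult a (imat_mult X b) else imat_mult a (imat_mult Y b))" for q and X Y :: "'a imat"
    by simp
  then show ?thesis by (simp add: y transform_def 1 2 3 fun_eq_iff)
qed

text \<open>Solve the rank condition for \<open>M l\<close>, dividing by \<open>c l\<close>; the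
  factorisation of the low-rank matrix fills the additional columns and rows.\<close>

lemma insert_matrix_surj:
  fixes M :: "nat \<Rightarrow> 'a::field imat"
  assumes x: "(M, P, Q, v) \<in> A_space (Suc p) n m d"
    and l: "l < Suc p" "c l \<noteq> 0" and rank: "rank_le (\<lambda>i j. \<Sum>q<Suc p. c q * M q i j) K"
  shows "\<exists>y\<in>A_space p (n + K) (m + K) (d + p). insert_matrix p n m d l K y = (M, P, Q, v)"
proof -
  from rank obtain A B where AB: "\<forall>i j. (\<Sum>q<Suc p. c q * M q i j) = (\<Sum>s<K. A i s * B s j)"
    unfolding rank_le_def by blast
  \<comment> \<open>Numbers the matrices other than \<open>l\<close>; its inverse is the reindexing
    in \<open>insert_matrix\<close>.\<close>
  define lift where "lift r = (if r < l then r else Suc r)" for r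
  have "bij_betw lift {..<p} ({..<Suc p} - {l})"
    by (rule bij_betw_byWitness[where f' = "\<lambda>q. if q < l then q else q - 1"])
       (use l(1) in \<open>auto simp: lift_def\<close>)
  from sum.reindex_bij_betw[OF this]
  have reindex: "(\<Sum>r<p. g (lift r)) = sum g ({..<Suc p} - {l})" for g :: "nat \<Rightarrow> 'a" .
  have Ml: "M l i j = (\<Sum>r<p. - c (lift r) / c l * M (lift r) i j) + (\<Sum>s<K. A i s / c l * B s j)" for i j
  proof -
    have "(\<Sum>s<K. A i s * B s j) = c l * M l i j + (\<Sum>q\<in>{..<Suc p} - {l}. c q * M q i j)"
      unfolding AB[rule_format, symmetric] using l(1) by (intro sum.remove) auto
    also have "(\<Sum>q\<in>{..<Suc p} - {l}. c q * M q i j) = (\<Sum>r<p. c (lift r) * M (lift r) i j)"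
      by (rule reindex[symmetric])
    finally have "M l i j = (\<Sum>s<K. A i s * B s j) / c l - (\<Sum>r<p. c (lift r) * M (lift r) i j) / c l"
      using l(2) by (simp add: field_simps)
    then show ?thesis by (simp add: sum_divide_distrib sum_negf)
  qed
  define y where "y = (\<lambda>r. M (lift r),
    \<lambda>i j. if j < n then P i j else if j < n + K then A i (j - n) / c l else 0,
    \<lambda>i j. if i < m then Q i j else if i < m + K then B (i - m) j else 0,
    \<lambda>q. if q < d then v q else if q < d + p then - c (lift (q - d)) / c l else 0)"
  have "y \<in> A_space p (n + K) (m + K) (d + p)"
    using x l(1) by (auto simp: y_def A_space_def lift_def)
  moreover have "insert_matrix p n m d l K y = (M, P, Q, v)"
  proof -
    have lift: "q < l \<Longrightarrow> lift q = q" "\<not> q < l \<Longrightarrow> q \<noteq> l \<Longrightarrow> lift (q - 1) = q" for q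
      by (auto simp: lift_def)
    show ?thesis
      unfolding y_def insert_matrix.simps prod.inject
    proof (intro conjI ext)
      fix q i j
      show "(if q = l then (\<Sum>r<p. (if d + r < d then v (d + r) else if d + r < d + p
            then - c (lift (d + r - d)) / c l else 0) * M (lift r) i j) +
          (\<Sum>s<K. (if n + s < n then P i (n + s) else if n + s < n + K then A i (n + s - n) / c l else 0) *
            (if m + s < m then Q (m + s) j else if m + s < m + K then B (m + s - m) j else 0))
        else M (lift (if q < l then q else q - 1)) i j) = M q i j"
        by (cases "q = l"; cases "q < l") (simp_all add: Ml lift del: One_nat_def)
    qed (use x in \<open>auto simp: A_space_def\<close>)
  qed
  ultimately show ?thesis by blast
qed

lemma insert_matrix_pullback:
  "\<exists>g. \<forall>y. value_at g y = value_at f (insert_matrix p n m d l K y :: 'a::field point)"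
proof -
  define \<sigma> :: "coord \<Rightarrow> (coord, 'a) mpol" where "\<sigma> c = (case c of
      Mat_coord q i j \<Rightarrow> if q = l then (\<Sum>r<p. Var (Vec_coord (d + r)) * Var (Mat_coord r i j)) +
          (\<Sum>s<K. Var (Left_coord i (n + s)) * Var (Right_coord (m + s) j))
        else Var (Mat_coord (if q < l then q else q - 1) i j)
    | Left_coord i j \<Rightarrow> if j < n then Var (Left_coord i j) else 0
    | Right_coord i j \<Rightarrow> if i < m then Var (Right_coord i j) else 0
    | Vec_coord q \<Rightarrow> if q < d then Var (Vec_coord q) else 0)" for c
  have "value_at (peval Const \<sigma> f) y = value_at f (insert_matrix p n m d l K y)" for y
    by (rule value_at_substitution, cases y)
       (auto simp: \<sigma>_def value_at_sum split: coord.splits)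
  then show ?thesis by blast
qed

section \<open>The inductive step\<close>

lemma fixed_matrices_pullback:
  "\<exists>g. \<forall>N P Q v. value_at g (N, P, Q, v) = value_at f (M, P, Q, v :: nat \<Rightarrow> 'a::field)"
proof -
  define \<sigma> :: "coord \<Rightarrow> (coord, 'a) mpol" where "\<sigma> c = (case c of
      Mat_coord q i j \<Rightarrow> Const (M q i j) | _ \<Rightarrow> Var c)" for c
  have "value_at (peval Const \<sigma> f) (N, P, Q, v) = value_at f (M, P, Q, v)" for N P Q v
    by (rule value_at_substitution) (auto simp: \<sigma>_def split: coord.splits)
  then show ?thesis by blast
qed

text \<open>If all partner sets were finite, a sequence jumping beyond the partners of each of its
  terms would contain no pair.\<close>

lemma infinitely_many_partners:
  fixes G :: "nat \<Rightarrow> nat \<Rightarrow> bool"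
  assumes "\<And>g :: nat \<Rightarrow> nat. strict_mono g \<Longrightarrow> \<exists>i j. i < j \<and> G (g i) (g j)"
  shows "\<exists>i. infinite {j. i < j \<and> G i j}"
proof (rule ccontr)
  assume "\<nexists>i. infinite {j. i < j \<and> G i j}"
  then have "finite {j. i < j \<and> G i j}" for i by blast
  then have "\<exists>b. \<forall>j\<in>{j. i < j \<and> G i j}. j < b" for i
    unfolding finite_nat_set_iff_bounded .
  then obtain b where b: "\<And>i. \<forall>j\<in>{j. i < j \<and> G i j}. j < b i" by metis
  define g where "g = rec_nat 0 (\<lambda>_ k. Suc (max k (b k)))"
  have g: "g (Suc k) = Suc (max (g k) (b (g k)))" for k by (simp add: g_def)
  have mono: "strict_mono g" unfolding strict_mono_Suc_iff using g by auto
  then obtain i j where ij: "i < j" "G (g i) (g j)" using assms by blast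
  have "g i < g j" using mono ij(1) by (simp add: strict_mono_less)
  then have "g j < b (g i)" using b ij(2) by blast
  also have "b (g i) \<le> g (Suc i)" using g by simp
  also have "\<dots> \<le> g j" using mono ij(1) by (simp add: strict_mono_less_eq)
  finally show False by simp
qed

lemma good_pairs_Suc:
  assumes inf: "infinite (UNIV :: 'a::field set)" and IH: "\<And>n m d. good_pairs TYPE('a) p n m d"
  shows "good_pairs TYPE('a) (Suc p) n m d"
  unfolding good_pairs_def
proof (intro allI impI, rule ccontr)
  fix x :: "nat \<Rightarrow> 'a point" and f
  assume xf: "\<forall>i. x i \<in> A_space (Suc p) n m d \<and> value_at (f i) (x i) \<noteq> 0"
    and "\<nexists>i j. i < j \<and> (\<exists>a\<in>carrier GL_inf. \<exists>b\<in>carrier GL_inf. value_at (f i) (transform a b (x j)) \<noteq> 0)"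
  then have bad: "value_at (f i) (transform a b (x j)) = 0"
    if "i < j" "a \<in> carrier GL_inf" "b \<in> carrier GL_inf" for i j a b
    using that by blast
  define M P Q v where "M k = fst (x k)" and "P k = fst (snd (x k))"
    and "Q k = fst (snd (snd (x k)))" and "v k = snd (snd (snd (x k)))" for k
  have x: "x k = (M k, P k, Q k, v k)" for k by (simp add: M_def P_def Q_def v_def)
  have xA: "(M k, P k, Q k, v k) \<in> A_space (Suc p) n m d" for k using xf x by metis
  \<comment> \<open>Forgets the matrices, so that the case \<open>p = 0\<close> applies.\<close>
  define base :: "nat \<Rightarrow> 'a point" where "base k = (\<lambda>_ _ _. 0, P k, Q k, v k)" for k
  have base: "base k \<in> A_space 0 n m d" for k using xA[of k] by (simp add: A_space_def base_def)
  \<comment> \<open>\<open>h i\<close> below is \<open>f i\<close> with its matrices frozen at those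
    of \<open>x i\<close>.\<close>
  have "\<forall>i. \<exists>g. \<forall>N P Q v. value_at g (N, P, Q, v) = value_at (f i) (M i, P, Q, v)"
    by (intro allI fixed_matrices_pullback)
  from choice[OF this] obtain h where
    h: "\<And>i N P Q v. value_at (h i) (N, P, Q, v) = value_at (f i) (M i, P, Q, v)"
    by blast
  have "value_at (h k) (base k) \<noteq> 0" for k
    using xf[rule_format, of k] by (simp add: base_def h x)
  then have pairs: "\<exists>i j. i < j \<and> (\<exists>a\<in>carrier GL_inf. \<exists>b\<in>carrier GL_inf.
      value_at (h (g i)) (transform a b (base (g j))) \<noteq> 0)" for g :: "nat \<Rightarrow> nat"
    using good_pairs_0[where 'a = 'a, of n m d, unfolded good_pairs_def, rule_format, of "base \<circ> g" "h \<circ> g"] base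
    by simp
  have "\<exists>i. infinite {j. i < j \<and> (\<exists>a\<in>carrier GL_inf. \<exists>b\<in>carrier GL_inf.
      value_at (h i) (transform a b (base j)) \<noteq> 0)}"
    by (rule infinitely_many_partners) (rule pairs)
  then obtain i where inf_i: "infinite {j. i < j \<and> (\<exists>a\<in>carrier GL_inf. \<exists>b\<in>carrier GL_inf.
      value_at (h i) (transform a b (base j)) \<noteq> 0)}" (is "infinite ?J")
    by (rule exE)
  obtain K where K: "\<forall>M M' P Q v. (M, P, Q, v) \<in> A_space (Suc p) n m d \<longrightarrow>
    (M', P, Q, v) \<in> A_space (Suc p) n m d \<longrightarrow> value_at (f i) (M', P, Q, v) \<noteq> 0 \<longrightarrow>
    (\<forall>a\<in>carrier GL_inf. \<forall>b\<in>carrier GL_inf. value_at (f i) (transform a b (M, P, Q, v)) = 0) \<longrightarrow>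
    (\<exists>c. (\<exists>l<Suc p. c l \<noteq> 0) \<and> rank_le (\<lambda>i j. \<Sum>k<Suc p. c k * M k i j) K)"
    using bounded_rank_of_vanishing[OF inf, of "Suc p" n m d "f i"] by (rule exE)
  have "\<exists>l\<in>{..<Suc p}. \<exists>y\<in>A_space p (n + K) (m + K) (d + p). insert_matrix p n m d l K y = x j"
    if j: "j \<in> ?J" for j
  proof -
    from j obtain a b where ab: "i < j" "a \<in> carrier GL_inf" "b \<in> carrier GL_inf"
      and nz: "value_at (h i) (transform a b (base j)) \<noteq> 0" by blast
    obtain M' P' Q' v' where t: "transform a b (x j) = (M', P', Q', v')"
      using prod_cases4 by blast
    have t': "transform a b (base j) = ((\<lambda>k. imat_mult a (imat_mult (\<lambda>_ _. 0) b)), P', Q', v')"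
      using t by (auto simp: transform_def base_def x)
    have A: "(M', P', Q', v') \<in> A_space (Suc p) n m d"
      using transform_A_space[of "x j" "Suc p" n m d a b] xf t by metis
    \<comment> \<open>\<open>f i\<close> is non-zero at this point but vanishes on the orbit of the
      translate of \<open>x j\<close>, which has the same \<open>P'\<close>, \<open>Q'\<close> and
      \<open>v'\<close>; hence the rank bound \<open>K\<close> applies.\<close>
    have "(M i, P', Q', v') \<in> A_space (Suc p) n m d"
      using A xA[of i] by (simp add: A_space_def)
    moreover have "value_at (f i) (M i, P', Q', v') \<noteq> 0" using nz unfolding t' h .
    moreover have "value_at (f i) (transform a' b' (M', P', Q', v')) = 0"
      if "a' \<in> carrier GL_inf" "b' \<in> carrier GL_inf" for a' b'
      unfolding t[symmetric] transform_transform_GL[OF that(1) ab(2) that(2) ab(3)]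
      by (intro bad ab GL_inf_mult_closed that)
    ultimately obtain c l where cl: "l < Suc p" "c l \<noteq> 0"
      "rank_le (\<lambda>i j. \<Sum>k<Suc p. c k * M' k i j) K"
      using K A by blast
    from insert_matrix_surj[OF A cl] obtain y where
      y: "y \<in> A_space p (n + K) (m + K) (d + p)" "insert_matrix p n m d l K y = transform a b (x j)"
      unfolding t by blast
    \<comment> \<open>Equivariance undoes the translation, so \<open>x j\<close> itself lies in the
      image.\<close>
    let ?a = "inv\<^bsub>GL_inf\<^esub> a" and ?b = "inv\<^bsub>GL_inf\<^esub> b"
    note inv = GL_inf_inv[OF ab(2)] GL_inf_inv[OF ab(3)]
    have "insert_matrix p n m d l K (transform ?a ?b y) = transform ?a ?b (transform a b (x j))"
      using inv y(2) by (simp add: insert_matrix_transform GL_inf_fin)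
    also have "\<dots> = x j"
      using inv ab by (simp add: transform_transform_GL transform_one)
    finally show ?thesis using cl(1) transform_A_space[OF y(1)] by blast
  qed
  then have "\<forall>j\<in>?J. \<exists>l\<in>{..<Suc p}. \<exists>y\<in>A_space p (n + K) (m + K) (d + p).
      insert_matrix p n m d l K y = x j" by blast
  \<comment> \<open>One position \<open>l\<close> serves infinitely many \<open>j\<close>. The bound
    \<open>K\<close> is common to all of them, since it belongs to \<open>f i\<close>.\<close>
  from pigeonhole_infinite_rel[OF inf_i finite_lessThan this] obtain l where
    "infinite {j \<in> ?J. \<exists>y\<in>A_space p (n + K) (m + K) (d + p). insert_matrix p n m d l K y = x j}"
    (is "infinite ?J'") by blast
  then obtain g :: "nat \<Rightarrow> nat" where g: "strict_mono g" "\<And>k. g k \<in> ?J'"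
    using infinite_enumerate[of ?J'] by blast
  then have "\<forall>k. \<exists>y. y \<in> A_space p (n + K) (m + K) (d + p) \<and> insert_matrix p n m d l K y = x (g k)"
    by blast
  then obtain y where y: "\<And>k. y k \<in> A_space p (n + K) (m + K) (d + p)"
    "\<And>k. insert_matrix p n m d l K (y k) = x (g k)" by metis
  \<comment> \<open>The pulled back polynomials and the preimages \<open>y k\<close> form a bad
    sequence with one matrix less, contradicting \<open>IH\<close>.\<close>
  have "\<forall>k. \<exists>f'. \<forall>y. value_at f' y = value_at (f (g k)) (insert_matrix p n m d l K y)"
    by (intro allI insert_matrix_pullback)
  from choice[OF this] obtain f' where
    f': "\<And>k y. value_at (f' k) y = value_at (f (g k)) (insert_matrix p n m d l K y)"
    by blast
  have "y k \<in> A_space p (n + K) (m + K) (d + p) \<and> value_at (f' k) (y k) \<noteq> 0" for k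
    using xf y f' by simp
  then obtain i' j' a b where *: "i' < j'" "a \<in> carrier GL_inf" "b \<in> carrier GL_inf"
    "value_at (f' i') (transform a b (y j')) \<noteq> 0"
    using IH[of "n + K" "m + K" "d + p", unfolded good_pairs_def] by blast
  have "value_at (f' i') (transform a b (y j')) = value_at (f (g i')) (transform a b (x (g j')))"
    using *(2,3) by (simp add: f' insert_matrix_transform GL_inf_fin y)
  moreover have "g i' < g j'" using g(1) *(1) by (simp add: strict_mono_less)
  ultimately show False using bad * by metis
qed

lemma good_pairs:
  assumes "infinite (UNIV :: 'a::field set)"
  shows "good_pairs TYPE('a) p n m d"
  by (induction p arbitrary: n m d) (auto intro: good_pairs_0 good_pairs_Suc[OF assms])

section \<open>Descending chains and finite generation\<close>

lemma transform_eq_A_act: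
  assumes "a \<in> carrier GL_inf" "b \<in> carrier GL_inf" "x \<in> A_space p n m d"
  shows "\<exists>\<gamma>\<in>carrier (GL_inf \<times>\<times> GL_inf). transform a b x = A_act p n m d \<gamma> (x :: 'a::field point)"
\<comment> \<open>The second factor acts through its inverse, hence the inverse of
  \<open>b\<close>.\<close>
proof (rule bexI[of _ "(a, inv\<^bsub>GL_inf\<^esub> b)"])
  show "transform a b x = A_act p n m d (a, inv\<^bsub>GL_inf\<^esub> b) x"
    by (simp only: A_act_def case_prod_conv restrict_apply' assms(3) GL_inf_inv(4)[OF assms(2)])
  show "(a, inv\<^bsub>GL_inf\<^esub> b) \<in> carrier (GL_inf \<times>\<times> GL_inf)"
    using assms(1) GL_inf_inv(1)[OF assms(2)] by simp
qed

text \<open>In a strictly descending subchain, take a point of each member outside the next one and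
  a polynomial that witnesses this. Stability of the members makes the sequence bad.\<close>

lemma equivariantly_noetherian_zariski:
  assumes "infinite (UNIV :: 'a::field set)"
  shows "equivariantly_noetherian (GL_inf \<times>\<times> GL_inf) (zariski p n m d :: 'a point topology) (A_act p n m d)"
  unfolding equivariantly_noetherian_def
proof (intro conjI acts_by_homeomorphisms_A_act allI impI, rule ccontr)
  fix C :: "nat \<Rightarrow> 'a point set"
  assume C: "\<forall>i. closedin (zariski p n m d) (C i) \<and> stable_set (GL_inf \<times>\<times> GL_inf) (A_act p n m d) (C i) \<and> C (Suc i) \<subseteq> C i"
    and unstable: "\<nexists>N. \<forall>i\<ge>N. C i = C N"
  have closed: "closedin (zariski p n m d) (C i)"
    and stable: "stable_set (GL_inf \<times>\<times> GL_inf) (A_act p n m d) (C i)" for i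
    using C by blast+
  have "C (Suc i) \<subseteq> C i" for i using C by blast
  then have anti: "C j \<subseteq> C i" if "i \<le> j" for i j using lift_Suc_antimono_le that by blast
  have CA: "C i \<subseteq> A_space p n m d" for i
    using closedin_subset[OF closed] unfolding topspace_zariski .
  have "\<exists>j>i. C j \<noteq> C i" for i using unstable by (metis le_neq_implies_less)
  then obtain s where s: "\<And>i. i < s i" "\<And>i. C (s i) \<noteq> C i" by metis
  \<comment> \<open>Jumping each time to a later index with a different set makes the subchain
    strict.\<close>
  define g where "g k = (s ^^ k) 0" for k
  have g: "g (Suc k) = s (g k)" for k by (simp add: g_def)
  have mono: "strict_mono g" unfolding strict_mono_Suc_iff using g s by simp
  have "\<exists>x f. x \<in> C (g k) \<and> value_at f x \<noteq> 0 \<and> (\<forall>y\<in>C (g (Suc k)). value_at f y = 0)" for k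
  proof -
    have "C (g (Suc k)) \<subset> C (g k)"
      using anti[of "g k" "g (Suc k)"] s[of "g k"] unfolding g by auto
    then obtain x where x: "x \<in> C (g k)" "x \<notin> C (g (Suc k))" by blast
    obtain F where F: "C (g (Suc k)) = zero_set p n m d F"
      using closed[of "g (Suc k)"] unfolding closedin_zariski by blast
    have "x \<in> A_space p n m d" using x(1) CA by blast
    then show ?thesis using x unfolding F zero_set_def by blast
  qed
  then obtain x f where xf: "\<And>k. x k \<in> C (g k)" "\<And>k. value_at (f k) (x k) \<noteq> 0"
    "\<And>k y. y \<in> C (g (Suc k)) \<Longrightarrow> value_at (f k) y = 0" by metis
  have xA: "x k \<in> A_space p n m d" for k
    using xf(1) CA by blast
  then obtain i j a b where *: "i < j" "a \<in> carrier GL_inf" "b \<in> carrier GL_inf"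
    "value_at (f i) (transform a b (x j)) \<noteq> 0"
    using good_pairs[OF assms, of p n m d, unfolded good_pairs_def] xf(2) by blast
  have "x j \<in> C (g (Suc i))"
    using xf(1)[of j] anti[of "g (Suc i)" "g j"] *(1) mono by (auto simp: strict_mono_less_eq)
  moreover obtain \<gamma> where "\<gamma> \<in> carrier (GL_inf \<times>\<times> GL_inf)" "transform a b (x j) = A_act p n m d \<gamma> (x j)"
    using transform_eq_A_act[OF *(2,3) xA] by blast
  ultimately have "transform a b (x j) \<in> C (g (Suc i))"
    using stable unfolding stable_set_def by metis
  then show False using xf(3) *(4) by blast
qed

text \<open>Otherwise equations of \<open>X\<close> can be chosen forever, each non-zero at a common
  zero of the orbits of the earlier ones; such a sequence is bad.\<close>

lemma stable_closed_set_finitely_generated: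
  assumes inf: "infinite (UNIV :: 'a::field set)"
    and X: "closedin (zariski p n m d) X" "stable_set (GL_inf \<times>\<times> GL_inf) (A_act p n m d) (X :: 'a point set)"
  shows "\<exists>F. finite F \<and> F \<subseteq> A_polys p n m d \<and>
    X = zero_set p n m d (\<Union>f\<in>F. orbit (GL_inf \<times>\<times> GL_inf) poly_act f)"
proof (rule ccontr)
  let ?G = "GL_inf \<times>\<times> (GL_inf :: 'a imat monoid)"
  let ?Z = "\<lambda>F. zero_set p n m d (\<Union>f\<in>F. orbit ?G poly_act f) :: 'a point set"
  assume none: "\<nexists>F. finite F \<and> F \<subseteq> A_polys p n m d \<and> X = ?Z F"
  obtain F where F: "F \<subseteq> A_polys p n m d" "X = zero_set p n m d F"
    using X(1) unfolding closedin_zariski by blast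
  \<comment> \<open>\<open>X\<close> is stable, so the whole orbit of each of its equations vanishes
    on it.\<close>
  have XZ: "X \<subseteq> ?Z F'" if "F' \<subseteq> F" for F'
  proof
    fix x assume x: "x \<in> X"
    then have xA: "x \<in> A_space p n m d" using F(2) by (simp add: zero_set_def)
    have "value_at (poly_act \<gamma> f) x = 0" if "\<gamma> \<in> carrier ?G" "f \<in> F" for \<gamma> f
    proof -
      have "A_act p n m d (inv\<^bsub>?G\<^esub> \<gamma>) x \<in> X"
        using X(2) x group.inv_closed[OF group_GL_GL that(1)] unfolding stable_set_def by blast
      then show ?thesis
        using value_at_poly_act[OF that(1) xA] that(2) unfolding F(2) zero_set_def by simp
    qed
    then show "x \<in> ?Z F'" using xA that unfolding zero_set_def orbit_def by blast
  qed
  \<comment> \<open>The choice at stage \<open>k\<close>: a common zero of the earlier orbits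
    together with an equation of \<open>X\<close> that excludes it.\<close>
  define W where "W h k r \<longleftrightarrow> snd r \<in> F \<and> fst r \<in> ?Z ((\<lambda>i. snd (h i)) ` {..<k}) \<and> value_at (snd r) (fst r) \<noteq> 0"
    for h :: "nat \<Rightarrow> 'a point \<times> (coord, 'a) mpol" and k r
  have "\<exists>h. \<forall>k. W h k (h k)"
  proof (rule dependent_wf_choice[of less_than])
    fix h h' :: "nat \<Rightarrow> 'a point \<times> (coord, 'a) mpol" and k r
    assume "\<And>z. (z, k) \<in> less_than \<Longrightarrow> h z = h' z"
    then have "(\<lambda>i. snd (h i)) ` {..<k} = (\<lambda>i. snd (h' i)) ` {..<k}" by (intro image_cong) auto
    then show "W h k r = W h' k r" unfolding W_def by simp
  next
    fix k h assume "\<And>i. (i, k) \<in> less_than \<Longrightarrow> W h i (h i)"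
    then have sub: "(\<lambda>i. snd (h i)) ` {..<k} \<subseteq> F" by (auto simp: W_def)
    have "finite ((\<lambda>i. snd (h i)) ` {..<k})" by simp
    then have "X \<noteq> ?Z ((\<lambda>i. snd (h i)) ` {..<k})" using none sub F(1) by blast
    then obtain x where x: "x \<in> ?Z ((\<lambda>i. snd (h i)) ` {..<k})" "x \<notin> X" using XZ[OF sub] by blast
    then obtain f where "f \<in> F" "value_at f x \<noteq> 0" unfolding F(2) zero_set_def by blast
    then have "W h k (x, f)" using x by (simp add: W_def)
    then show "\<exists>r. W h k r" by blast
  qed simp
  then obtain h where h: "\<And>k. W h k (h k)" by blast
  define x f where "x k = fst (h k)" and "f k = snd (h k)" for k
  have xf: "x k \<in> ?Z (f ` {..<k})" "value_at (f k) (x k) \<noteq> 0" for k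
    using h[of k] unfolding W_def x_def f_def by blast+
  have xA: "x k \<in> A_space p n m d" for k using xf(1)[of k] unfolding zero_set_def by blast
  then obtain i j a b where *: "i < j" "a \<in> carrier GL_inf" "b \<in> carrier GL_inf"
    "value_at (f i) (transform a b (x j)) \<noteq> 0"
    using good_pairs[OF inf, of p n m d, unfolded good_pairs_def] xf(2) by blast
  obtain \<gamma> where \<gamma>: "\<gamma> \<in> carrier ?G" "transform a b (x j) = A_act p n m d \<gamma> (x j)"
    using transform_eq_A_act[OF *(2,3) xA] by blast
  \<comment> \<open>Moves the group element from the point to the polynomial: \<open>f i\<close> at
    the translate of \<open>x j\<close> by \<open>\<gamma>\<close> is
    \<open>poly_act ?\<delta> (f i)\<close> at \<open>x j\<close>.\<close>
  let ?\<delta> = "inv\<^bsub>?G\<^esub> \<gamma>"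
  have \<delta>: "?\<delta> \<in> carrier ?G" by (rule group.inv_closed[OF group_GL_GL \<gamma>(1)])
  have "poly_act ?\<delta> (f i) \<in> (\<Union>f\<in>f ` {..<j}. orbit ?G poly_act f)"
    using *(1) \<delta> unfolding orbit_def by blast
  then have "value_at (poly_act ?\<delta> (f i)) (x j) = 0" using xf(1)[of j] unfolding zero_set_def by blast
  then show False
    using value_at_poly_act[OF \<delta> xA, of "f i"] *(4) \<gamma> group.inv_inv[OF group_GL_GL \<gamma>(1)] by simp
qed

theorem theorem1p5:
  fixes p n m d :: nat
  assumes "infinite (UNIV :: 'a::field set)"
  shows "equivariantly_noetherian (GL_inf \<times>\<times> GL_inf)
           (zariski p n m d :: 'a point topology) (A_act p n m d) \<and>
         (\<forall>X :: 'a point set.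
            closedin (zariski p n m d) X \<and> stable_set (GL_inf \<times>\<times> GL_inf) (A_act p n m d) X \<longrightarrow>
            (\<exists>F. finite F \<and> F \<subseteq> A_polys p n m d \<and>
                 X = zero_set p n m d (\<Union>f\<in>F. orbit (GL_inf \<times>\<times> GL_inf) poly_act f)))"
  by (intro conjI allI impI equivariantly_noetherian_zariski[OF assms])
     (elim conjE, rule stable_closed_set_finitely_generated[OF assms])

end
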